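(* Let $H\in(\frac12,1)$, $\alpha\in(\frac12,H)$, $a\in\mathbb{R}\setminus\{0\}$, $b\in\mathbb{R}^d$, and let $f:\mathbb{R}^d\to\mathbb{R}^d$ satisfy the linear growth, one-sided dissipative Lipschitz and integrability conditions recalled in the context. Let $U_t=e^{-aO_t}(X_t+\frac ba)-\frac ba$. For any bounded time interval $[T_1,T_2]\subset\mathbb{R}$, the following statements are equivalent (pathwise): (i) $X_t\in C^\alpha([T_1,T_2],\mathbb{R}^d)$ satisfies $$dX_t=f(X_t)\,dt+(aX_t+b)\,dB^H_t.$$ (ii) $U_t\in C^\alpha([T_1,T_2],\mathbb{R}^d)$ satisfies $$\frac{dU}{dt}=e^{-aO_t}f\Big(U_te^{aO_t}+\frac ba(e^{aO_t}-1)\Big)+(aU_t+b)O_t.$$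
   Context: Norm and inner product are Euclidean on $\mathbb{R}^d$. $C^\alpha(I,\mathbb{R}^d)$ is the space of $\alpha$-Hölder continuous functions on the compact interval $I$. Conditions on $f$: (linear growth) there are $l,M>0$ with $\|f(x)\|\le l\|x\|+M$ for all $x$; (one-sided dissipative Lipschitz) there is $L>0$ with $\langle x-y,f(x)-f(y)\rangle\le -L\|x-y\|^2$ for all $x,y$; (integrability) there is $m_0>0$ such that $\int_{-\infty}^0 e^{ms}\|f(u(s))\|^2ds<\infty$ for every $m\in(0,m_0]$ and every continuous $u:\mathbb{R}\to\mathbb{R}^d$ of sub-exponential growth (for every $\epsilon>0$ there are $C>0$, $t_0$ with $\|u(t)\|\le Ce^{\epsilon|t|}$ for $|t|\ge t_0$). $B^H_t$, $t\in\mathbb{R}$, is a two-sided one-dimensional fractional Brownian motion with Hurst parameter $H$, whose paths are taken $\alpha$-Hölder continuous on every bounded interval and of at most polynomial growth. $O_t=e^{-t}\int_{-\infty}^te^s\,dB^H_s=B^H_t-\int_{-\infty}^te^{-(t-s)}B^H_s\,ds$ is the fractional Ornstein–Uhlenbeck process, satisfying $dO_t=-O_t\,dt+dB^H_t$; its paths are also $\alpha$-Hölder continuous on bounded intervals. Both equations are understood in integral form: for $s,t\in[T_1,T_2]$, $X_t-X_s=\int_s^tf(X_r)\,dr+\int_s^t(aX_r+b)\,dB^H_r$ and $U_t-U_s=\int_s^t\big[e^{-aO_r}f(U_re^{aO_r}+\frac ba(e^{aO_r}-1))+(aU_r+b)O_r\big]dr$. The integral against $B^H$ is the pathwise Young integral: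 for $Y\in C^{\alpha}$, $Z\in C^{\beta}$ with $\alpha+\beta>1$, $\int Y\,dZ=\lim_{|\mathcal{P}|\to0}\sum_{[s,t]\in\mathcal{P}}Y_s(Z_t-Z_s)$ over partitions $\mathcal{P}$ of mesh $|\mathcal{P}|$. *)

theory Defs
  imports "HOL-Probability.Probability"
begin

definition holder_on :: "real \<Rightarrow> real set \<Rightarrow> (real \<Rightarrow> 'a::real_normed_vector) \<Rightarrow> bool" where
  "holder_on \<alpha> I x \<longleftrightarrow> (\<exists>C. \<forall>s\<in>I. \<forall>t\<in>I. norm (x t - x s) \<le> C * \<bar>t - s\<bar> powr \<alpha>)"


subsection \<open>Conditions on the drift\<close>

definition linear_growth :: "('a::real_normed_vector \<Rightarrow> 'a) \<Rightarrow> bool" where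
  "linear_growth f \<longleftrightarrow> (\<exists>l>0. \<exists>M>0. \<forall>x. norm (f x) \<le> l * norm x + M)"

definition dissipative_lipschitz :: "('a::real_inner \<Rightarrow> 'a) \<Rightarrow> bool" where
  "dissipative_lipschitz f \<longleftrightarrow>
     (\<exists>L>0. \<forall>x y. (x - y) \<bullet> (f x - f y) \<le> - L * (norm (x - y))\<^sup>2)"

definition subexponential_growth :: "(real \<Rightarrow> 'a::real_normed_vector) \<Rightarrow> bool" where
  "subexponential_growth u \<longleftrightarrow>
     (\<forall>\<epsilon>>0. \<exists>C>0. \<exists>t0. \<forall>t. \<bar>t\<bar> \<ge> t0 \<longrightarrow> norm (u t) \<le> C * exp (\<epsilon> * \<bar>t\<bar>))"

definition integrability_condition :: "('a::real_normed_vector \<Rightarrow> 'a) \<Rightarrow> bool" where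
  "integrability_condition f \<longleftrightarrow>
     (\<exists>m0>0. \<forall>m\<in>{0<..m0}. \<forall>u. continuous_on UNIV u \<longrightarrow> subexponential_growth u \<longrightarrow>
        set_integrable lebesgue {..0} (\<lambda>s. exp (m * s) * (norm (f (u s)))\<^sup>2))"


subsection \<open>The pathwise Young integral\<close>

definition is_partition :: "real \<Rightarrow> real \<Rightarrow> nat \<Rightarrow> (nat \<Rightarrow> real) \<Rightarrow> bool" where
  "is_partition s t n p \<longleftrightarrow> p 0 = s \<and> p n = t \<and> (\<forall>i<n. p i < p (Suc i))"

definition left_sums_converge ::
  "(real \<Rightarrow> 'a::real_normed_vector) \<Rightarrow> (real \<Rightarrow> real) \<Rightarrow> real \<Rightarrow> real \<Rightarrow> 'a \<Rightarrow> bool" where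
  "left_sums_converge Y Z s t J \<longleftrightarrow>
     (\<forall>\<epsilon>>0. \<exists>\<delta>>0. \<forall>n p. is_partition s t n p \<longrightarrow> (\<forall>i<n. p (Suc i) - p i < \<delta>) \<longrightarrow>
        norm ((\<Sum>i<n. (Z (p (Suc i)) - Z (p i)) *\<^sub>R Y (p i)) - J) < \<epsilon>)"

text \<open>Oriented: for \<open>t < s\<close> the integral from \<open>s\<close> to \<open>t\<close> is minus the one from \<open>t\<close> to \<open>s\<close>.\<close>

definition has_young_integral ::
  "(real \<Rightarrow> 'a::real_normed_vector) \<Rightarrow> (real \<Rightarrow> real) \<Rightarrow> real \<Rightarrow> real \<Rightarrow> 'a \<Rightarrow> bool" where
  "has_young_integral Y Z s t J \<longleftrightarrow>
     (if s \<le> t then left_sums_converge Y Z s t J else left_sums_converge Y Z t s (- J))"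

definition young_integral ::
  "(real \<Rightarrow> 'a::real_normed_vector) \<Rightarrow> (real \<Rightarrow> real) \<Rightarrow> real \<Rightarrow> real \<Rightarrow> 'a" where
  "young_integral Y Z s t = (THE J. has_young_integral Y Z s t J)"


subsection \<open>Fractional Brownian motion and the fractional Ornstein--Uhlenbeck process\<close>

text \<open>Point masses count as Gaussian, so that degenerate linear combinations are covered.\<close>

definition gaussian_rv :: "'w measure \<Rightarrow> ('w \<Rightarrow> real) \<Rightarrow> bool" where
  "gaussian_rv M Y \<longleftrightarrow> Y \<in> borel_measurable M \<and>
     ((\<exists>\<mu>. AE \<omega> in M. Y \<omega> = \<mu>) \<or>
      (\<exists>\<mu> \<sigma>. \<sigma> > 0 \<and> distributed M lborel Y (normal_density \<mu> \<sigma>)))"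

definition gaussian_process :: "'w measure \<Rightarrow> ('t \<Rightarrow> 'w \<Rightarrow> real) \<Rightarrow> bool" where
  "gaussian_process M X \<longleftrightarrow> prob_space M \<and>
     (\<forall>S c. finite S \<longrightarrow> gaussian_rv M (\<lambda>\<omega>. \<Sum>t\<in>S. c t * X t \<omega>))"

definition fractional_brownian_motion ::
  "'w measure \<Rightarrow> real \<Rightarrow> (real \<Rightarrow> 'w \<Rightarrow> real) \<Rightarrow> bool" where
  "fractional_brownian_motion M H B \<longleftrightarrow> gaussian_process M B \<and>
     (\<forall>t. (\<integral>\<omega>. B t \<omega> \<partial>M) = 0) \<and>
     (\<forall>s t. (\<integral>\<omega>. B s \<omega> * B t \<omega> \<partial>M) =
        (\<bar>s\<bar> powr (2 * H) + \<bar>t\<bar> powr (2 * H) - \<bar>t - s\<bar> powr (2 * H)) / 2)"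

definition polynomial_growth :: "(real \<Rightarrow> real) \<Rightarrow> bool" where
  "polynomial_growth \<beta> \<longleftrightarrow> (\<exists>C. \<exists>k::nat. \<forall>t. \<bar>\<beta> t\<bar> \<le> C * (1 + \<bar>t\<bar> ^ k))"

text \<open>The path at time \<open>t\<close> of the fractional Ornstein--Uhlenbeck process driven by the path \<open>\<beta>\<close>;
  the integral over \<open>(-\<infinity>, t]\<close> is the improper Young integral.\<close>

definition fOU :: "(real \<Rightarrow> real) \<Rightarrow> real \<Rightarrow> real" where
  "fOU \<beta> t = exp (- t) * Lim at_bot (\<lambda>T. young_integral exp \<beta> T t)"


subsection \<open>The two equations in integral form\<close>

text \<open>Existence of the integrals is part of being a solution. The drift is not assumed continuous,
  so the time integrals are Lebesgue integrals.\<close>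

definition solves_sde ::
  "('a::euclidean_space \<Rightarrow> 'a) \<Rightarrow> real \<Rightarrow> 'a \<Rightarrow> (real \<Rightarrow> real) \<Rightarrow> real set \<Rightarrow> (real \<Rightarrow> 'a) \<Rightarrow> bool" where
  "solves_sde f a b \<beta> I x \<longleftrightarrow> (\<forall>s\<in>I. \<forall>t\<in>I.
     interval_lebesgue_integrable lebesgue (ereal s) (ereal t) (\<lambda>r. f (x r)) \<and>
     (\<exists>J. has_young_integral (\<lambda>r. a *\<^sub>R x r + b) \<beta> s t J \<and>
        x t - x s = (LINT r=ereal s..ereal t|lebesgue. f (x r)) + J))"

definition solves_ode :: "(real \<Rightarrow> 'a::euclidean_space \<Rightarrow> 'a) \<Rightarrow> real set \<Rightarrow> (real \<Rightarrow> 'a) \<Rightarrow> bool" where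
  "solves_ode g I u \<longleftrightarrow> (\<forall>s\<in>I. \<forall>t\<in>I.
     interval_lebesgue_integrable lebesgue (ereal s) (ereal t) (\<lambda>r. g r (u r)) \<and>
     u t - u s = (LINT r=ereal s..ereal t|lebesgue. g r (u r)))"

end

theory Submission
  imports Defs
begin

text \<open>
  The statement is pathwise: it is enough to fix one driving path \<open>\<beta>\<close> and its Ornstein--Uhlenbeck
  path \<open>O\<close>, and \<open>O\<close> only enters through the Langevin equation \<open>dO = - O dt + d\<beta>\<close> and its
  \<open>\<alpha>\<close>-Hoelder continuity. Put \<open>y = x + b/a\<close> and \<open>v = u + b/a = e y\<close> with \<open>e = exp (- a O)\<close>.
  Formally \<open>dy = f(x) dt + a y d\<beta>\<close>, and the product rule gives
  \<open>dv = e f(x) dt + a y e d\<beta> - a e y dO = e f(x) dt + a O v dt\<close>, which is the ordinary equation.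

  This becomes rigorous by working with quantities depending on two times \<open>s \<le> t\<close> (germs) up to errors
  of order \<open>(t - s) powr (2 * \<alpha>)\<close>, where \<open>2 * \<alpha>\<close> exceeds one. Provided that its drift is integrable,
  each of the two equations holds if and only if its defect over \<open>{s..t}\<close>, with the integral against
  \<open>\<beta>\<close> replaced by its left-point approximation, is of this order. In one direction, a limit of Riemann
  sums stays within this order of the left-point approximation, by comparison of successive dyadic
  partitions (\<open>riemann_limit_estimate\<close>). In the other, an additive germ that is locally approximated to an order
  larger than one is the limit of the Riemann sums of the approximation
  (\<open>riemann_sums_converge_additive\<close>); this supplies the existence of the Young integral.
  These are \<open>solves_sde_iff_germ_order\<close> and \<open>solves_ode_iff_germ_order\<close>.

  It remains to compare the two defects, which is a first-order Taylor expansion of the exponential: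
  the defect of the ordinary equation equals \<open>e s\<close> times the defect of the stochastic one up to
  order \<open>2 * \<alpha>\<close> (\<open>ode_defect_eq\<close>, \<open>ode_defect_order\<close>). Since \<open>e\<close> and \<open>1 / e\<close> are bounded on a
  compact interval, one defect is of order \<open>2 * \<alpha>\<close> exactly if the other one is.

  The Langevin equation comes from integrating \<open>exp\<close> against \<open>\<beta>\<close> by parts, which is again an
  instance of \<open>riemann_sums_converge_additive\<close>; polynomial growth of \<open>\<beta>\<close> makes the improper integral
  at \<open>-\<infinity>\<close> converge.
\<close>

section \<open>Orders of two-parameter germs\<close>

text \<open>
  A germ is a function of two times \<open>s \<le> t\<close>, typically the increment of a path over \<open>{s..t}\<close> or a
  local approximation to one. Germs of order larger than one are negligible: their sums over a
  partition vanish as the mesh tends to zero. Only \<open>s \<le> t\<close> is constrained, so integrals over \<open>{s..t}\<close>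
  may be used as germs without orienting them.
\<close>

definition germ_order ::
  "real \<Rightarrow> real set \<Rightarrow> (real \<Rightarrow> real \<Rightarrow> 'a::real_normed_vector) \<Rightarrow> bool" where
  "germ_order \<theta> I E \<longleftrightarrow> (\<exists>C. \<forall>s\<in>I. \<forall>t\<in>I. s \<le> t \<longrightarrow> norm (E s t) \<le> C * (t - s) powr \<theta>)"

lemma germ_orderI:
  assumes "\<And>s t. s \<in> I \<Longrightarrow> t \<in> I \<Longrightarrow> s \<le> t \<Longrightarrow> norm (E s t) \<le> C * (t - s) powr \<theta>"
  shows "germ_order \<theta> I E"
  using assms unfolding germ_order_def by blast

lemma germ_orderE:
  assumes "germ_order \<theta> I E"
  obtains C where "C \<ge> 0"
    "\<And>s t. s \<in> I \<Longrightarrow> t \<in> I \<Longrightarrow> s \<le> t \<Longrightarrow> norm (E s t) \<le> C * (t - s) powr \<theta>"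
proof -
  obtain C where C: "\<And>s t. s \<in> I \<Longrightarrow> t \<in> I \<Longrightarrow> s \<le> t \<Longrightarrow> norm (E s t) \<le> C * (t - s) powr \<theta>"
    using assms unfolding germ_order_def by blast
  have "norm (E s t) \<le> max C 0 * (t - s) powr \<theta>" if "s \<in> I" "t \<in> I" "s \<le> t" for s t
    using C[OF that] by (rule order_trans) (intro mult_right_mono, auto)
  then show ?thesis
    using that[of "max C 0"] by auto
qed

lemma germ_order_cong:
  assumes "\<And>s t. s \<in> I \<Longrightarrow> t \<in> I \<Longrightarrow> s \<le> t \<Longrightarrow> E s t = F s t"
  shows "germ_order \<theta> I E \<longleftrightarrow> germ_order \<theta> I F"
  unfolding germ_order_def by (simp add: assms cong: ball_cong imp_cong)

lemma germ_order_subset: "germ_order \<theta> I E \<Longrightarrow> J \<subseteq> I \<Longrightarrow> germ_order \<theta> J E"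
  unfolding germ_order_def by blast

lemma germ_order_add:
  assumes "germ_order \<theta> I E" "germ_order \<theta> I F"
  shows "germ_order \<theta> I (\<lambda>s t. E s t + F s t)"
proof -
  obtain C where C: "\<And>s t. s \<in> I \<Longrightarrow> t \<in> I \<Longrightarrow> s \<le> t \<Longrightarrow> norm (E s t) \<le> C * (t - s) powr \<theta>"
    using assms(1) by (elim germ_orderE) blast
  obtain D where D: "\<And>s t. s \<in> I \<Longrightarrow> t \<in> I \<Longrightarrow> s \<le> t \<Longrightarrow> norm (F s t) \<le> D * (t - s) powr \<theta>"
    using assms(2) by (elim germ_orderE) blast
  show ?thesis
    by (rule germ_orderI[where C="C + D"], unfold distrib_right)
       (intro order_trans[OF norm_triangle_ineq] add_mono C D)
qed

lemma germ_order_minus: "germ_order \<theta> I E \<Longrightarrow> germ_order \<theta> I (\<lambda>s t. - E s t)"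
  unfolding germ_order_def by simp

lemma germ_order_diff:
  assumes "germ_order \<theta> I E" "germ_order \<theta> I F"
  shows "germ_order \<theta> I (\<lambda>s t. E s t - F s t)"
  using germ_order_add[OF assms(1) germ_order_minus[OF assms(2)]] by simp

text \<open>
  Orders add under products: the source of the exponent \<open>2 * \<alpha>\<close>.
\<close>

lemma germ_order_scaleR:
  assumes "germ_order p I E" "germ_order q I F"
  shows "germ_order (p + q) I (\<lambda>s t. E s t *\<^sub>R F s t)"
proof -
  obtain C where C: "C \<ge> 0"
    "\<And>s t. s \<in> I \<Longrightarrow> t \<in> I \<Longrightarrow> s \<le> t \<Longrightarrow> norm (E s t) \<le> C * (t - s) powr p"
    using assms(1) by (elim germ_orderE) blast
  obtain D where D: "D \<ge> 0"
    "\<And>s t. s \<in> I \<Longrightarrow> t \<in> I \<Longrightarrow> s \<le> t \<Longrightarrow> norm (F s t) \<le> D * (t - s) powr q"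
    using assms(2) by (elim germ_orderE) blast
  show ?thesis
  proof (rule germ_orderI)
    fix s t assume st: "s \<in> I" "t \<in> I" "s \<le> t"
    have "norm (E s t *\<^sub>R F s t) \<le> (C * (t - s) powr p) * (D * (t - s) powr q)"
      unfolding norm_scaleR real_norm_def[symmetric]
      by (intro mult_mono C D st) (use C in auto)
    then show "norm (E s t *\<^sub>R F s t) \<le> (C * D) * (t - s) powr (p + q)"
      by (simp add: powr_add algebra_simps)
  qed
qed

lemma germ_order_bounded_scaleR:
  assumes "bounded (c ` I)" "germ_order \<theta> I E"
  shows "germ_order \<theta> I (\<lambda>s t. c s *\<^sub>R E s t)"
proof -
  obtain C where C: "C \<ge> 0"
    "\<And>s t. s \<in> I \<Longrightarrow> t \<in> I \<Longrightarrow> s \<le> t \<Longrightarrow> norm (E s t) \<le> C * (t - s) powr \<theta>"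
    using assms(2) by (elim germ_orderE) blast
  obtain K where K: "\<And>s. s \<in> I \<Longrightarrow> norm (c s) \<le> K"
    using assms(1) unfolding bounded_iff by blast
  show ?thesis
  proof (rule germ_orderI)
    fix s t assume st: "s \<in> I" "t \<in> I" "s \<le> t"
    have "0 \<le> K"
      using K[OF st(1)] norm_ge_zero order_trans by blast
    then have "norm (c s *\<^sub>R E s t) \<le> K * (C * (t - s) powr \<theta>)"
      unfolding norm_scaleR real_norm_def[symmetric]
      by (intro mult_mono C K st) auto
    then show "norm (c s *\<^sub>R E s t) \<le> (K * C) * (t - s) powr \<theta>"
      by (simp add: algebra_simps)
  qed
qed

lemma germ_order_scaleR_bounded:
  assumes "bounded (v ` I)" "germ_order \<theta> I e"
  shows "germ_order \<theta> I (\<lambda>s t. e s t *\<^sub>R v s)"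
proof -
  have "germ_order \<theta> I (\<lambda>s t. norm (v s) *\<^sub>R e s t)"
    using assms by (intro germ_order_bounded_scaleR) (auto simp: bounded_iff)
  then show ?thesis
    by (simp add: germ_order_def abs_mult mult.commute)
qed

lemma germ_order_antimono:
  assumes "germ_order q {S..T} E" "p \<le> q"
  shows "germ_order p {S..T} E"
proof -
  obtain C where C: "C \<ge> 0"
    "\<And>s t. s \<in> {S..T} \<Longrightarrow> t \<in> {S..T} \<Longrightarrow> s \<le> t \<Longrightarrow> norm (E s t) \<le> C * (t - s) powr q"
    using assms(1) by (elim germ_orderE) blast
  show ?thesis
  proof (rule germ_orderI)
    fix s t assume st: "s \<in> {S..T}" "t \<in> {S..T}" "s \<le> t"
    have "(t - s) powr q = (t - s) powr (q - p) * (t - s) powr p"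
      by (simp flip: powr_add)
    also have "\<dots> \<le> (T - S) powr (q - p) * (t - s) powr p"
      using st assms(2) by (intro mult_right_mono powr_mono2) auto
    finally have "C * (t - s) powr q \<le> C * ((T - S) powr (q - p) * (t - s) powr p)"
      using C(1) by (rule mult_left_mono)
    with C(2)[OF st] show "norm (E s t) \<le> (C * (T - S) powr (q - p)) * (t - s) powr p"
      by simp
  qed
qed

text \<open>
  Integrating over \<open>{s..t}\<close> gains one order. The integrand may depend on the endpoints, as it does when
  the value of a path at \<open>r\<close> is compared with its value at \<open>s\<close> or \<open>t\<close>. The bound is asked for
  \<open>s < t\<close> only, so that it covers \<open>p = 0\<close>, where \<open>0 powr 0 = 0\<close> would force the integrand to vanish.
\<close>

lemma germ_order_integral:
  fixes E :: "real \<Rightarrow> real \<Rightarrow> real \<Rightarrow> 'a::euclidean_space"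
  assumes "\<And>s t. S \<le> s \<Longrightarrow> s < t \<Longrightarrow> t \<le> T \<Longrightarrow> E s t integrable_on {s..t}"
    and "\<And>s t r. S \<le> s \<Longrightarrow> s < t \<Longrightarrow> t \<le> T \<Longrightarrow> r \<in> {s..t} \<Longrightarrow> norm (E s t r) \<le> C * (t - s) powr p"
  shows "germ_order (1 + p) {S..T} (\<lambda>s t. integral {s..t} (E s t))"
proof (rule germ_orderI)
  fix s t assume st: "s \<in> {S..T}" "t \<in> {S..T}" "s \<le> t"
  show "norm (integral {s..t} (E s t)) \<le> C * (t - s) powr (1 + p)"
  proof (cases "s = t")
    case False
    with st have "s < t" by simp
    with st have "norm (integral {s..t} (E s t)) \<le> integral {s..t} (\<lambda>_. C * (t - s) powr p)"
      by (intro integral_norm_bound_integral assms(1)) (auto intro: assms(2))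
    also have "\<dots> = C * (t - s) powr (1 + p)"
      using \<open>s < t\<close> by (simp add: powr_add)
    finally show ?thesis .
  qed simp
qed

lemma germ_order_integral_bounded:
  fixes h :: "real \<Rightarrow> 'a::euclidean_space"
  assumes "h integrable_on {S..T}" "bounded (h ` {S..T})"
  shows "germ_order 1 {S..T} (\<lambda>s t. integral {s..t} h)"
proof -
  obtain K where K: "\<And>r. r \<in> {S..T} \<Longrightarrow> norm (h r) \<le> K"
    using assms(2) unfolding bounded_iff by blast
  have "germ_order (1 + 0) {S..T} (\<lambda>s t. integral {s..t} ((\<lambda>s t. h) s t))"
    by (rule germ_order_integral[where C=K])
       (auto intro: integrable_subinterval_real[OF assms(1)] K)
  then show ?thesis by simp
qed

lemma holder_on_iff_germ_order: "holder_on \<alpha> I x \<longleftrightarrow> germ_order \<alpha> I (\<lambda>s t. x t - x s)"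
proof
  assume "germ_order \<alpha> I (\<lambda>s t. x t - x s)"
  then obtain C where C: "\<And>s t. s \<in> I \<Longrightarrow> t \<in> I \<Longrightarrow> s \<le> t \<Longrightarrow> norm (x t - x s) \<le> C * (t - s) powr \<alpha>"
    by (elim germ_orderE) blast
  have "norm (x t - x s) \<le> C * \<bar>t - s\<bar> powr \<alpha>" if "s \<in> I" "t \<in> I" for s t
    using C[OF that] C[OF that(2) that(1)] by (cases "s \<le> t") (auto simp: norm_minus_commute)
  then show "holder_on \<alpha> I x"
    unfolding holder_on_def by blast
qed (force simp: holder_on_def germ_order_def)

section \<open>Hoelder functions on a compact interval\<close>

lemma holder_on_imp_continuous_on:
  assumes "holder_on \<alpha> I x" "\<alpha> > 0"
  shows "continuous_on I x"
  unfolding continuous_on_def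
proof
  fix s assume s: "s \<in> I"
  obtain C where C: "\<forall>s\<in>I. \<forall>t\<in>I. norm (x t - x s) \<le> C * \<bar>t - s\<bar> powr \<alpha>"
    using assms(1) unfolding holder_on_def by blast
  have "((\<lambda>t. C * \<bar>t - s\<bar> powr \<alpha>) \<longlongrightarrow> C * \<bar>s - s\<bar> powr \<alpha>) (at s within I)"
    using assms(2)
    by (intro tendsto_mult tendsto_const tendsto_powr2 tendsto_rabs tendsto_diff tendsto_ident_at) auto
  then have "((\<lambda>t. C * \<bar>t - s\<bar> powr \<alpha>) \<longlongrightarrow> 0) (at s within I)"
    by simp
  then have "((\<lambda>t. x t - x s) \<longlongrightarrow> 0) (at s within I)"
    by (rule Lim_null_comparison[rotated]) (use C s in \<open>auto simp: eventually_at_filter\<close>)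
  then show "(x \<longlongrightarrow> x s) (at s within I)"
    by (rule LIM_zero_cancel)
qed

lemma holder_on_imp_bounded:
  assumes "holder_on \<alpha> {S..T} x" "\<alpha> > 0"
  shows "bounded (x ` {S..T})"
  using holder_on_imp_continuous_on[OF assms] by (intro compact_imp_bounded compact_continuous_image) auto

lemma holder_on_cong: "(\<And>t. t \<in> I \<Longrightarrow> x t = y t) \<Longrightarrow> holder_on \<alpha> I x \<longleftrightarrow> holder_on \<alpha> I y"
  unfolding holder_on_def by auto

lemma holder_on_add_const: "holder_on \<alpha> I x \<Longrightarrow> holder_on \<alpha> I (\<lambda>t. x t + c)"
  unfolding holder_on_def by simp

lemma holder_on_scaleR:
  fixes c :: "real \<Rightarrow> real"
  assumes "holder_on \<alpha> {S..T} c" "holder_on \<alpha> {S..T} x" "\<alpha> > 0"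
  shows "holder_on \<alpha> {S..T} (\<lambda>t. c t *\<^sub>R x t)"
proof -
  have c: "germ_order \<alpha> {S..T} (\<lambda>s t. c t - c s)" and x: "germ_order \<alpha> {S..T} (\<lambda>s t. x t - x s)"
    using assms by (auto simp: holder_on_iff_germ_order)
  have "germ_order \<alpha> {S..T} (\<lambda>s t. (c t - c s) *\<^sub>R (x t - x s))"
    using germ_order_antimono[OF germ_order_scaleR[OF c x]] assms(3) by simp
  moreover have "germ_order \<alpha> {S..T} (\<lambda>s t. (c t - c s) *\<^sub>R x s)"
    by (rule germ_order_scaleR_bounded[OF holder_on_imp_bounded[OF assms(2,3)] c])
  moreover have "germ_order \<alpha> {S..T} (\<lambda>s t. c s *\<^sub>R (x t - x s))"
    by (rule germ_order_bounded_scaleR[OF holder_on_imp_bounded[OF assms(1,3)] x])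
  ultimately have "germ_order \<alpha> {S..T}
      (\<lambda>s t. (c t - c s) *\<^sub>R (x t - x s) + (c t - c s) *\<^sub>R x s + c s *\<^sub>R (x t - x s))"
    by (intro germ_order_add)
  then show ?thesis
    unfolding holder_on_iff_germ_order
    by (rule back_subst) (intro arg_cong[where f="germ_order \<alpha> {S..T}"] ext, simp add: algebra_simps)
qed

text \<open>
  Both bounds are the tangent inequality \<open>1 + z \<le> exp z\<close>, used at \<open>y\<close> and at \<open>x\<close>. The second one
  controls the Taylor remainder by a product of two increments.
\<close>

lemma exp_linearization_bounds:
  fixes x y :: real
  shows "0 \<le> exp x - exp y - exp y * (x - y)"
    and "exp x - exp y - exp y * (x - y) \<le> (x - y) * (exp x - exp y)"
proof -
  have "exp y * (1 + (x - y)) \<le> exp y * exp (x - y)"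
    by (intro mult_left_mono exp_ge_add_one_self) auto
  then show "0 \<le> exp x - exp y - exp y * (x - y)"
    by (simp add: algebra_simps flip: exp_add)
  have "exp x * (1 + (y - x)) \<le> exp x * exp (y - x)"
    by (intro mult_left_mono exp_ge_add_one_self) auto
  then show "exp x - exp y - exp y * (x - y) \<le> (x - y) * (exp x - exp y)"
    by (simp add: algebra_simps flip: exp_add)
qed

text \<open>
  The exponential is Lipschitz on the bounded range of \<open>x\<close>.
\<close>

lemma holder_on_exp:
  fixes x :: "real \<Rightarrow> real"
  assumes "holder_on \<alpha> {S..T} x" "\<alpha> > 0"
  shows "holder_on \<alpha> {S..T} (\<lambda>t. exp (x t))"
proof -
  have x: "germ_order \<alpha> {S..T} (\<lambda>s t. x t - x s)"
    using assms(1) by (simp add: holder_on_iff_germ_order)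
  obtain C where C: "C \<ge> 0"
    "\<And>s t. s \<in> {S..T} \<Longrightarrow> t \<in> {S..T} \<Longrightarrow> s \<le> t \<Longrightarrow> norm (x t - x s) \<le> C * (t - s) powr \<alpha>"
    using x by (elim germ_orderE) blast
  obtain K where K: "\<And>s. s \<in> {S..T} \<Longrightarrow> norm (x s) \<le> K"
    using holder_on_imp_bounded[OF assms] unfolding bounded_iff by blast
  have lip: "\<bar>exp u - exp v\<bar> \<le> exp K * \<bar>u - v\<bar>" if "u \<le> K" "v \<le> K" for u v :: real
  proof -
    have "exp u - exp v \<le> exp K * \<bar>u - v\<bar>" if "u \<le> K" for u v :: real
    proof -
      have "exp u - exp v \<le> exp u * (u - v)"
        using exp_linearization_bounds(1)[of v u] by (simp add: algebra_simps)
      also have "\<dots> \<le> exp u * \<bar>u - v\<bar>"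
        by (intro mult_left_mono) auto
      also have "\<dots> \<le> exp K * \<bar>u - v\<bar>"
        using that by (intro mult_right_mono) auto
      finally show ?thesis .
    qed
    from this[OF that(1), of v] this[OF that(2), of u] show ?thesis
      by (simp add: abs_minus_commute)
  qed
  show ?thesis
    unfolding holder_on_iff_germ_order
  proof (rule germ_orderI)
    fix s t assume st: "s \<in> {S..T}" "t \<in> {S..T}" "s \<le> t"
    have "norm (exp (x t) - exp (x s)) \<le> exp K * \<bar>x t - x s\<bar>"
      using lip[of "x t" "x s"] K[OF st(1)] K[OF st(2)] by simp
    also have "\<dots> \<le> exp K * (C * (t - s) powr \<alpha>)"
      using C(2)[OF st] by (intro mult_left_mono) auto
    finally show "norm (exp (x t) - exp (x s)) \<le> (exp K * C) * (t - s) powr \<alpha>"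
      by simp
  qed
qed

lemma germ_order_exp_linearization:
  fixes x :: "real \<Rightarrow> real"
  assumes "holder_on \<alpha> {S..T} x" "\<alpha> > 0"
  shows "germ_order (2 * \<alpha>) {S..T} (\<lambda>s t. exp (x t) - exp (x s) - exp (x s) * (x t - x s))"
proof -
  have "germ_order (\<alpha> + \<alpha>) {S..T} (\<lambda>s t. (x t - x s) *\<^sub>R (exp (x t) - exp (x s)))"
    using assms(1) holder_on_exp[OF assms]
    by (intro germ_order_scaleR) (auto simp: holder_on_iff_germ_order)
  then obtain C where C: "\<And>s t. s \<in> {S..T} \<Longrightarrow> t \<in> {S..T} \<Longrightarrow> s \<le> t \<Longrightarrow>
      norm ((x t - x s) *\<^sub>R (exp (x t) - exp (x s))) \<le> C * (t - s) powr (\<alpha> + \<alpha>)"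
    by (elim germ_orderE) blast
  show ?thesis
  proof (rule germ_orderI[where C=C])
    fix s t assume st: "s \<in> {S..T}" "t \<in> {S..T}" "s \<le> t"
    show "norm (exp (x t) - exp (x s) - exp (x s) * (x t - x s)) \<le> C * (t - s) powr (2 * \<alpha>)"
      using C[OF st] exp_linearization_bounds[where x="x t" and y="x s"] by simp
  qed
qed

section \<open>Limits of Riemann sums of germs\<close>

text \<open>
  Left-point sums are the case \<open>\<Xi> u v = (Z v - Z u) *\<^sub>R Y u\<close>. Allowing an arbitrary germ \<open>\<Xi>\<close> also
  covers \<open>\<Xi> = 0\<close>, which is used to show that an additive germ of order larger than one vanishes.
\<close>

definition riemann_sums_converge ::
  "(real \<Rightarrow> real \<Rightarrow> 'a::real_normed_vector) \<Rightarrow> real \<Rightarrow> real \<Rightarrow> 'a \<Rightarrow> bool" where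
  "riemann_sums_converge \<Xi> s t J \<longleftrightarrow>
     (\<forall>\<epsilon>>0. \<exists>\<delta>>0. \<forall>n p. is_partition s t n p \<longrightarrow> (\<forall>i<n. p (Suc i) - p i < \<delta>) \<longrightarrow>
        norm ((\<Sum>i<n. \<Xi> (p i) (p (Suc i))) - J) < \<epsilon>)"

lemma left_sums_converge_iff_riemann:
  "left_sums_converge Y Z s t J \<longleftrightarrow> riemann_sums_converge (\<lambda>u v. (Z v - Z u) *\<^sub>R Y u) s t J"
  unfolding left_sums_converge_def riemann_sums_converge_def ..

lemma is_partition_bounds:
  assumes "is_partition s t n p" "i \<le> n"
  shows "s \<le> p i" "p i \<le> t"
proof -
  have mono: "p i \<le> p j" if "i \<le> j" "j \<le> n" for i j
    using that
  proof (induction j rule: dec_induct)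
    case (step k)
    then have "p i \<le> p k" "p k < p (Suc k)"
      using assms(1) by (auto simp: is_partition_def)
    then show ?case by simp
  qed simp
  show "s \<le> p i" "p i \<le> t"
    using mono[of 0 i] mono[of i n] assms by (auto simp: is_partition_def)
qed

definition uniform_grid :: "real \<Rightarrow> real \<Rightarrow> nat \<Rightarrow> nat \<Rightarrow> real" where
  "uniform_grid s t n i = s + real i * ((t - s) / real n)"

lemma is_partition_uniform_grid:
  assumes "s < t" "n > 0"
  shows "is_partition s t n (uniform_grid s t n)"
  using assms by (auto simp: is_partition_def uniform_grid_def divide_simps algebra_simps)

lemma uniform_grid_step: "uniform_grid s t n (Suc i) - uniform_grid s t n i = (t - s) / real n"
  by (simp add: uniform_grid_def algebra_simps add_divide_distrib diff_divide_distrib)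

lemma riemann_sums_converge_uniform_grid:
  assumes "riemann_sums_converge \<Xi> s t J" "s < t" "filterlim m at_top sequentially"
  shows "(\<lambda>k. \<Sum>i<m k. \<Xi> (uniform_grid s t (m k) i) (uniform_grid s t (m k) (Suc i))) \<longlonglongrightarrow> J"
proof (rule tendstoI)
  fix \<epsilon> :: real assume "\<epsilon> > 0"
  then obtain \<delta> where \<delta>: "\<delta> > 0"
    "\<And>n p. is_partition s t n p \<Longrightarrow> \<forall>i<n. p (Suc i) - p i < \<delta> \<Longrightarrow>
       norm ((\<Sum>i<n. \<Xi> (p i) (p (Suc i))) - J) < \<epsilon>"
    using assms(1) unfolding riemann_sums_converge_def by meson
  have "filterlim (\<lambda>k. real (m k)) at_top sequentially"
    using assms(3) by (rule filterlim_compose[OF filterlim_real_sequentially])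
  then have "eventually (\<lambda>k. real (m k) > (t - s) / \<delta>) sequentially"
    unfolding filterlim_at_top_dense by blast
  moreover have "eventually (\<lambda>k. m k > 0) sequentially"
    using assms(3) eventually_gt_at_top[of 0] unfolding filterlim_iff by blast
  ultimately show "eventually (\<lambda>k. dist (\<Sum>i<m k. \<Xi> (uniform_grid s t (m k) i)
      (uniform_grid s t (m k) (Suc i))) J < \<epsilon>) sequentially"
  proof eventually_elim
    case (elim k)
    then have "(t - s) / real (m k) < \<delta>"
      using \<delta>(1) by (simp add: field_simps)
    then show ?case
      unfolding dist_norm
      by (intro \<delta>(2) is_partition_uniform_grid) (use assms(2) elim in \<open>auto simp: uniform_grid_step\<close>)
  qed
qed

text \<open>
  For \<open>s < t\<close> both limits are attained along the uniform grids, whose mesh tends to zero. For \<open>s = t\<close> the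
  only partition is the one without steps, whose sum is zero.
\<close>

lemma riemann_sums_converge_unique:
  assumes "riemann_sums_converge \<Xi> s t J" "riemann_sums_converge \<Xi> s t J'" "s \<le> t"
  shows "J = J'"
proof (cases "s = t")
  case False
  with assms(3) have "s < t" by simp
  then show ?thesis
    using LIMSEQ_unique riemann_sums_converge_uniform_grid[OF assms(1) _ filterlim_ident]
      riemann_sums_converge_uniform_grid[OF assms(2) _ filterlim_ident] by blast
next
  case True
  have "K = 0" if "riemann_sums_converge \<Xi> s t K" for K
  proof -
    have "norm K < \<epsilon>" if "\<epsilon> > 0" for \<epsilon>
    proof -
      have "is_partition s t 0 (\<lambda>_. s)"
        using True by (simp add: is_partition_def)
      then show ?thesis
        using \<open>riemann_sums_converge \<Xi> s t K\<close> that unfolding riemann_sums_converge_def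
        by fastforce
    qed
    then show "K = 0"
      by (metis less_irrefl zero_less_norm_iff)
  qed
  with assms show ?thesis by blast
qed

text \<open>
  By additivity \<open>I s t\<close> is itself a sum over any partition, so it differs from the Riemann sum of \<open>\<Xi>\<close>
  by at most \<open>C\<close> times the sum of the \<open>\<theta>\<close>-th powers of the step lengths. This is at most
  \<open>C * (t - s)\<close> times the \<open>(\<theta> - 1)\<close>-th power of the mesh.
\<close>

lemma riemann_sums_converge_additive:
  fixes I :: "real \<Rightarrow> real \<Rightarrow> 'a::real_normed_vector"
  assumes add: "\<And>r u v. s \<le> r \<Longrightarrow> r \<le> u \<Longrightarrow> u \<le> v \<Longrightarrow> v \<le> t \<Longrightarrow> I r v = I r u + I u v"
    and order: "germ_order \<theta> {s..t} (\<lambda>u v. I u v - \<Xi> u v)" and "\<theta> > 1" and "s \<le> t"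
  shows "riemann_sums_converge \<Xi> s t (I s t)"
  unfolding riemann_sums_converge_def
proof (intro allI impI)
  fix \<epsilon> :: real assume "\<epsilon> > 0"
  obtain C where C: "C \<ge> 0"
    "\<And>u v. u \<in> {s..t} \<Longrightarrow> v \<in> {s..t} \<Longrightarrow> u \<le> v \<Longrightarrow> norm (I u v - \<Xi> u v) \<le> C * (v - u) powr \<theta>"
    using order by (elim germ_orderE) blast
  \<comment> \<open>The summand 1 keeps \<open>K\<close> positive if \<open>C = 0\<close> or \<open>s = t\<close>.
    The mesh bound is chosen so that \<open>C * (t - s) * \<delta> powr (\<theta> - 1) < \<epsilon>\<close>.\<close>
  define K where "K = C * (t - s) + 1"
  have "K > 0"
    using C(1) \<open>s \<le> t\<close> by (simp add: K_def add_nonneg_pos)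
  define \<delta> where "\<delta> = (\<epsilon> / K) powr (1 / (\<theta> - 1))"
  have \<delta>: "\<delta> > 0" "\<delta> powr (\<theta> - 1) = \<epsilon> / K"
    using \<open>\<epsilon> > 0\<close> \<open>K > 0\<close> \<open>\<theta> > 1\<close> by (auto simp: \<delta>_def powr_powr)
  show "\<exists>\<delta>>0. \<forall>n p. is_partition s t n p \<longrightarrow> (\<forall>i<n. p (Suc i) - p i < \<delta>) \<longrightarrow>
          norm ((\<Sum>i<n. \<Xi> (p i) (p (Suc i))) - I s t) < \<epsilon>"
  proof (intro exI[of _ \<delta>] conjI allI impI)
    fix n p assume p: "is_partition s t n p" and mesh: "\<forall>i<n. p (Suc i) - p i < \<delta>"
    have "I s (p m) = (\<Sum>i<m. I (p i) (p (Suc i)))" if "m \<le> n" for m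
      using that
    proof (induction m)
      case 0
      have "I s s = I s s + I s s"
        using \<open>s \<le> t\<close> by (intro add) auto
      then show ?case
        using p by (simp add: is_partition_def)
    next
      case (Suc m)
      have "I s (p (Suc m)) = I s (p m) + I (p m) (p (Suc m))"
        using is_partition_bounds[OF p] p Suc.prems
        by (intro add) (auto simp: is_partition_def intro: less_imp_le)
      then show ?case
        using Suc by simp
    qed
    from this[of n] have "I s t = (\<Sum>i<n. I (p i) (p (Suc i)))"
      using p by (simp add: is_partition_def)
    then have "norm ((\<Sum>i<n. \<Xi> (p i) (p (Suc i))) - I s t)
        = norm (\<Sum>i<n. I (p i) (p (Suc i)) - \<Xi> (p i) (p (Suc i)))"
      by (simp add: sum_subtractf norm_minus_commute)
    also have "\<dots> \<le> (\<Sum>i<n. C * (\<epsilon> / K) * (p (Suc i) - p i))"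
    proof (intro sum_norm_le)
      fix i assume i: "i \<in> {..<n}"
      have lt: "p i < p (Suc i)"
        using p i by (auto simp: is_partition_def)
      have "norm (I (p i) (p (Suc i)) - \<Xi> (p i) (p (Suc i))) \<le> C * (p (Suc i) - p i) powr \<theta>"
        using lt i is_partition_bounds[OF p] by (intro C) auto
      also have "(p (Suc i) - p i) powr \<theta> = (p (Suc i) - p i) powr (\<theta> - 1) * (p (Suc i) - p i)"
        using lt powr_add[of "p (Suc i) - p i" "\<theta> - 1" 1] by simp
      also have "C * ((p (Suc i) - p i) powr (\<theta> - 1) * (p (Suc i) - p i))
          \<le> C * (\<delta> powr (\<theta> - 1) * (p (Suc i) - p i))"
        using lt mesh i \<open>\<theta> > 1\<close> C(1)
        by (intro mult_left_mono mult_right_mono powr_mono2) (auto intro: less_imp_le)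
      finally show "norm (I (p i) (p (Suc i)) - \<Xi> (p i) (p (Suc i))) \<le> C * (\<epsilon> / K) * (p (Suc i) - p i)"
        by (simp add: \<delta> mult.assoc)
    qed
    also have "\<dots> = C * (\<epsilon> / K) * (\<Sum>i<n. p (Suc i) - p i)"
      by (rule sum_distrib_left[symmetric])
    also have "(\<Sum>i<n. p (Suc i) - p i) = t - s"
      using p by (simp add: sum_lessThan_telescope is_partition_def)
    also have "C * (\<epsilon> / K) * (t - s) < \<epsilon>"
      using \<open>K > 0\<close> \<open>\<epsilon> > 0\<close> by (simp add: K_def field_simps)
    finally show "norm ((\<Sum>i<n. \<Xi> (p i) (p (Suc i))) - I s t) < \<epsilon>" .
  qed (use \<delta> in auto)
qed

lemma uniform_grid_double_even: "n > 0 \<Longrightarrow> uniform_grid s t (2 * n) (2 * i) = uniform_grid s t n i"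
  by (simp add: uniform_grid_def)

lemma sum_lessThan_double:
  fixes g :: "nat \<Rightarrow> 'a::comm_monoid_add"
  shows "(\<Sum>i<2 * n. g i) = (\<Sum>i<n. g (2 * i) + g (Suc (2 * i)))"
  by (induction n) (auto simp: algebra_simps)

text \<open>
  Passing from the dyadic grid with \<open>2 ^ k\<close> cells to the next one changes the sum by at most
  \<open>2 ^ k * C * ((t - s) / 2 ^ k) powr \<theta>\<close>, the \<open>k\<close>-th term of a geometric series with ratio
  \<open>2 powr (1 - \<theta>) < 1\<close>. The coarsest grid contributes \<open>\<Xi> s t\<close>. The existence of the limit \<open>J\<close> is a
  hypothesis, so that only dyadic partitions have to be compared.
\<close>

lemma riemann_limit_estimate:
  fixes \<Xi> :: "real \<Rightarrow> real \<Rightarrow> 'a::real_normed_vector"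
  assumes lim: "riemann_sums_converge \<Xi> s t J" and "s \<le> t" and "\<theta> > 1" and "C \<ge> 0"
    and coherent: "\<And>r u v. s \<le> r \<Longrightarrow> r \<le> u \<Longrightarrow> u \<le> v \<Longrightarrow> v \<le> t \<Longrightarrow>
      norm (\<Xi> r u + \<Xi> u v - \<Xi> r v) \<le> C * (v - r) powr \<theta>"
  shows "norm (J - \<Xi> s t) \<le> C / (1 - 2 powr (1 - \<theta>)) * (t - s) powr \<theta>"
proof (cases "s = t")
  case True
  have "\<Xi> s s = 0"
    using coherent[of s s s] True by simp
  moreover have "riemann_sums_converge \<Xi> s t 0"
    unfolding riemann_sums_converge_def
  proof (intro allI impI exI[of _ 1] conjI)
    fix \<epsilon> :: real and n p
    assume "\<epsilon> > 0" and p: "is_partition s t n p"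
    have "n = 0"
    proof (rule ccontr)
      assume "n \<noteq> 0"
      then show False
        using is_partition_bounds[OF p, of 0] is_partition_bounds[OF p, of 1] p True
        by (auto simp: is_partition_def)
    qed
    then show "norm ((\<Sum>i<n. \<Xi> (p i) (p (Suc i))) - 0) < \<epsilon>"
      using \<open>\<epsilon> > 0\<close> by simp
  qed simp
  ultimately show ?thesis
    using riemann_sums_converge_unique[OF lim _ \<open>s \<le> t\<close>, of 0] True by simp
next
  case False
  with \<open>s \<le> t\<close> have "s < t" by simp
  define h where "h = t - s"
  define q where "q = (2::real) powr (1 - \<theta>)"
  have q: "0 < q" "q < 1"
    using \<open>\<theta> > 1\<close> powr_less_mono[of "1 - \<theta>" 0 2] by (auto simp: q_def)
  define \<sigma> where "\<sigma> k = (\<Sum>i<2 ^ k. \<Xi> (uniform_grid s t (2 ^ k) i) (uniform_grid s t (2 ^ k) (Suc i)))" for k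
  have step: "norm (\<sigma> (Suc k) - \<sigma> k) \<le> C * h powr \<theta> * q ^ k" for k
  proof -
    define w where "w = uniform_grid s t (2 ^ k)"
    \<comment> \<open>the midpoints of the cells of the coarser grid\<close>
    define m where "m i = uniform_grid s t (2 * 2 ^ k) (Suc (2 * i))" for i
    have w: "is_partition s t (2 ^ k) w"
      unfolding w_def using \<open>s < t\<close> by (rule is_partition_uniform_grid) simp
    have even: "uniform_grid s t (2 * 2 ^ k) (2 * i) = w i" for i
      unfolding w_def by (rule uniform_grid_double_even) simp
    have wm: "w i \<le> m i" "m i \<le> w (Suc i)" for i
      using uniform_grid_step[of s t "2 * 2 ^ k" "2 * i"]
        uniform_grid_step[of s t "2 * 2 ^ k" "Suc (2 * i)"] even[of i] even[of "Suc i"] \<open>s < t\<close>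
      by (smt (verit) m_def divide_nonneg_nonneg of_nat_0_le_iff mult_Suc_right add_2_eq_Suc)+
    have "\<sigma> (Suc k) = (\<Sum>i<2 ^ k. \<Xi> (w i) (m i) + \<Xi> (m i) (w (Suc i)))"
      using even[of "Suc _"] by (simp add: \<sigma>_def sum_lessThan_double even m_def)
    then have "\<sigma> (Suc k) - \<sigma> k
        = (\<Sum>i<2 ^ k. \<Xi> (w i) (m i) + \<Xi> (m i) (w (Suc i)) - \<Xi> (w i) (w (Suc i)))"
      by (simp add: \<sigma>_def w_def sum_subtractf)
    also have "norm \<dots> \<le> (\<Sum>i<(2::nat) ^ k. C * (h / 2 ^ k) powr \<theta>)"
    proof (intro sum_norm_le)
      fix i assume i: "i \<in> {..<(2::nat) ^ k}"
      have "norm (\<Xi> (w i) (m i) + \<Xi> (m i) (w (Suc i)) - \<Xi> (w i) (w (Suc i)))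
          \<le> C * (w (Suc i) - w i) powr \<theta>"
        using is_partition_bounds[OF w] i wm by (intro coherent) auto
      also have "w (Suc i) - w i = h / 2 ^ k"
        by (simp add: w_def uniform_grid_step h_def)
      finally show "norm (\<Xi> (w i) (m i) + \<Xi> (m i) (w (Suc i)) - \<Xi> (w i) (w (Suc i)))
          \<le> C * (h / 2 ^ k) powr \<theta>" .
    qed
    also have "\<dots> = C * h powr \<theta> * (2 ^ k * (2 ^ k) powr - \<theta>)"
      using \<open>s < t\<close> by (simp add: h_def powr_divide powr_minus divide_simps)
    also have "2 ^ k * (2 ^ k) powr - \<theta> = q ^ k"
    proof -
      have "2 ^ k * (2 ^ k) powr - \<theta> = (2::real) powr (real k + real k * - \<theta>)"
        by (simp only: powr_add powr_powr[symmetric] powr_realpow)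
      also have "real k + real k * - \<theta> = (1 - \<theta>) * real k"
        by (simp add: algebra_simps)
      also have "2 powr ((1 - \<theta>) * real k) = q ^ k"
        by (simp add: q_def powr_powr flip: powr_realpow)
      finally show ?thesis .
    qed
    finally show ?thesis .
  qed
  have partial: "norm (\<sigma> k - \<sigma> 0) \<le> C / (1 - q) * h powr \<theta>" for k
  proof -
    have "norm (\<sigma> k - \<sigma> 0) = norm (\<Sum>j<k. \<sigma> (Suc j) - \<sigma> j)"
      by (simp add: sum_lessThan_telescope)
    also have "\<dots> \<le> (\<Sum>j<k. C * h powr \<theta> * q ^ j)"
      by (intro sum_norm_le step)
    also have "\<dots> = C * h powr \<theta> * (\<Sum>j<k. q ^ j)"
      by (simp add: sum_distrib_left)
    also have "\<dots> \<le> C * h powr \<theta> * (1 / (1 - q))"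
    proof (intro mult_left_mono)
      show "(\<Sum>j<k. q ^ j) \<le> 1 / (1 - q)"
        using q by (simp add: sum_gp_strict divide_right_mono)
    qed (use \<open>C \<ge> 0\<close> in auto)
    finally show ?thesis by simp
  qed
  have "\<sigma> \<longlonglongrightarrow> J"
    unfolding \<sigma>_def using lim \<open>s < t\<close>
  proof (rule riemann_sums_converge_uniform_grid)
    show "filterlim (\<lambda>k. (2::nat) ^ k) at_top sequentially"
      by (rule filterlim_at_top_mono[OF filterlim_ident]) (auto intro: less_imp_le)
  qed
  then have "(\<lambda>k. norm (\<sigma> k - \<sigma> 0)) \<longlonglongrightarrow> norm (J - \<sigma> 0)"
    by (intro tendsto_intros)
  then have "norm (J - \<sigma> 0) \<le> C / (1 - q) * h powr \<theta>"
    by (rule LIMSEQ_le_const2) (use partial in blast)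
  moreover have "\<sigma> 0 = \<Xi> s t"
    by (simp add: \<sigma>_def uniform_grid_def)
  ultimately show ?thesis
    by (simp add: q_def h_def)
qed

text \<open>
  The Young--Loeve estimate: refining the left-point germ at \<open>u\<close> changes it by
  \<open>(Z v - Z u) *\<^sub>R (Y u - Y r)\<close>, a product of two increments of order \<open>\<alpha>\<close>.
\<close>

lemma young_limit_estimate:
  fixes Y :: "real \<Rightarrow> 'a::real_normed_vector"
  assumes Y: "holder_on \<alpha> {S..T} Y" and Z: "holder_on \<alpha> {S..T} Z" and "\<alpha> > 1 / 2"
    and J: "\<And>s t. s \<in> {S..T} \<Longrightarrow> t \<in> {S..T} \<Longrightarrow> s \<le> t \<Longrightarrow> left_sums_converge Y Z s t (J s t)"
  shows "germ_order (2 * \<alpha>) {S..T} (\<lambda>s t. J s t - (Z t - Z s) *\<^sub>R Y s)"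
proof -
  obtain C where C: "C \<ge> 0"
    "\<And>s t. s \<in> {S..T} \<Longrightarrow> t \<in> {S..T} \<Longrightarrow> s \<le> t \<Longrightarrow> norm (Y t - Y s) \<le> C * (t - s) powr \<alpha>"
    using Y unfolding holder_on_iff_germ_order by (elim germ_orderE) blast
  obtain D where D: "D \<ge> 0"
    "\<And>s t. s \<in> {S..T} \<Longrightarrow> t \<in> {S..T} \<Longrightarrow> s \<le> t \<Longrightarrow> norm (Z t - Z s) \<le> D * (t - s) powr \<alpha>"
    using Z unfolding holder_on_iff_germ_order by (elim germ_orderE) blast
  show ?thesis
  proof (rule germ_orderI)
    fix s t assume st: "s \<in> {S..T}" "t \<in> {S..T}" "s \<le> t"
    show "norm (J s t - (Z t - Z s) *\<^sub>R Y s)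
        \<le> D * C / (1 - 2 powr (1 - 2 * \<alpha>)) * (t - s) powr (2 * \<alpha>)"
    proof (rule riemann_limit_estimate)
      show "riemann_sums_converge (\<lambda>u v. (Z v - Z u) *\<^sub>R Y u) s t (J s t)"
        using J[OF st] by (simp add: left_sums_converge_iff_riemann)
      fix r u v assume ruv: "s \<le> r" "r \<le> u" "u \<le> v" "v \<le> t"
      have "(Z u - Z r) *\<^sub>R Y r + (Z v - Z u) *\<^sub>R Y u - (Z v - Z r) *\<^sub>R Y r
          = (Z v - Z u) *\<^sub>R (Y u - Y r)"
        by (simp add: algebra_simps)
      also have "norm \<dots> \<le> (D * (v - u) powr \<alpha>) * (C * (u - r) powr \<alpha>)"
        unfolding norm_scaleR real_norm_def[symmetric] using ruv st D(1)
        by (intro mult_mono C D) auto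
      also have "\<dots> \<le> (D * (v - r) powr \<alpha>) * (C * (v - r) powr \<alpha>)"
        using ruv \<open>\<alpha> > 1 / 2\<close> C(1) D(1) by (intro mult_mono mult_left_mono powr_mono2) auto
      also have "\<dots> = D * C * (v - r) powr (2 * \<alpha>)"
        by (simp flip: powr_add)
      finally show "norm ((Z u - Z r) *\<^sub>R Y r + (Z v - Z u) *\<^sub>R Y u - (Z v - Z r) *\<^sub>R Y r)
          \<le> D * C * (v - r) powr (2 * \<alpha>)" .
    qed (use st C(1) D(1) \<open>\<alpha> > 1 / 2\<close> in auto)
  qed
qed

section \<open>The Ornstein--Uhlenbeck path\<close>

text \<open>
  Integration by parts. The right-hand side is additive in the interval, and it differs from the
  left-point germ by the integral of \<open>exp r * (\<beta> v - \<beta> r)\<close>, which has order \<open>1 + \<alpha>\<close>.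
\<close>

lemma left_sums_converge_exp:
  fixes \<beta> :: "real \<Rightarrow> real"
  assumes \<beta>: "holder_on \<alpha> {s..t} \<beta>" and "\<alpha> > 0" and "s \<le> t"
  shows "left_sums_converge exp \<beta> s t
    (exp t * \<beta> t - exp s * \<beta> s - integral {s..t} (\<lambda>r. exp r * \<beta> r))"
proof -
  define I where "I u v = exp v * \<beta> v - exp u * \<beta> u - integral {u..v} (\<lambda>r. exp r * \<beta> r)" for u v
  have cont: "continuous_on {s..t} \<beta>"
    using holder_on_imp_continuous_on \<beta> \<open>\<alpha> > 0\<close> by blast
  have int: "(\<lambda>r. exp r * \<beta> r) integrable_on {u..v}" if "s \<le> u" "v \<le> t" for u v
    using that by (intro integrable_continuous_interval continuous_intros continuous_on_subset[OF cont]) auto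
  have expint: "(exp has_integral (exp v - exp u)) {u..v}" if "u \<le> v" for u v :: real
    using that by (intro fundamental_theorem_of_calculus)
      (auto intro!: derivative_eq_intros simp flip: has_real_derivative_iff_has_vector_derivative)
  obtain C where C: "C \<ge> 0"
    "\<And>u v. u \<in> {s..t} \<Longrightarrow> v \<in> {s..t} \<Longrightarrow> u \<le> v \<Longrightarrow> norm (\<beta> v - \<beta> u) \<le> C * (v - u) powr \<alpha>"
    using \<beta> unfolding holder_on_iff_germ_order by (elim germ_orderE) blast
  have "germ_order (1 + \<alpha>) {s..t} (\<lambda>u v. integral {u..v} (\<lambda>r. exp r * (\<beta> v - \<beta> r)))"
  proof (rule germ_order_integral)
    fix u v assume uv: "s \<le> u" "u < v" "v \<le> t"
    then show "(\<lambda>r. exp r * (\<beta> v - \<beta> r)) integrable_on {u..v}"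
      by (intro integrable_continuous_interval continuous_intros continuous_on_subset[OF cont]) auto
    fix r assume r: "r \<in> {u..v}"
    have "norm (\<beta> v - \<beta> r) \<le> C * (v - r) powr \<alpha>"
      using uv r by (intro C) auto
    also have "\<dots> \<le> C * (v - u) powr \<alpha>"
      using uv r C(1) \<open>\<alpha> > 0\<close> by (intro mult_left_mono powr_mono2) auto
    finally have "norm (exp r * (\<beta> v - \<beta> r)) \<le> exp t * (C * (v - u) powr \<alpha>)"
      unfolding norm_mult using r uv by (intro mult_mono) auto
    then show "norm (exp r * (\<beta> v - \<beta> r)) \<le> (exp t * C) * (v - u) powr \<alpha>"
      by simp
  qed
  moreover have "integral {u..v} (\<lambda>r. exp r * (\<beta> v - \<beta> r)) = I u v - (\<beta> v - \<beta> u) *\<^sub>R exp u"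
    if "u \<in> {s..t}" "v \<in> {s..t}" "u \<le> v" for u v
  proof -
    have "((\<lambda>r. exp r * \<beta> v - exp r * \<beta> r) has_integral
        ((exp v - exp u) * \<beta> v - integral {u..v} (\<lambda>r. exp r * \<beta> r))) {u..v}"
      using that by (intro has_integral_diff has_integral_mult_left expint integrable_integral int) auto
    then show ?thesis
      by (simp add: I_def algebra_simps integral_unique)
  qed
  ultimately have "germ_order (1 + \<alpha>) {s..t} (\<lambda>u v. I u v - (\<beta> v - \<beta> u) *\<^sub>R exp u)"
    by (subst (asm) germ_order_cong) auto
  then have "riemann_sums_converge (\<lambda>u v. (\<beta> v - \<beta> u) *\<^sub>R exp u) s t (I s t)"
  proof (rule riemann_sums_converge_additive[rotated])
    fix r u v assume ruv: "s \<le> r" "r \<le> u" "u \<le> v" "v \<le> t"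
    then have "integral {r..u} (\<lambda>r. exp r * \<beta> r) + integral {u..v} (\<lambda>r. exp r * \<beta> r)
        = integral {r..v} (\<lambda>r. exp r * \<beta> r)"
      by (intro Henstock_Kurzweil_Integration.integral_combine int) auto
    then show "I r v = I r u + I u v"
      by (simp add: I_def)
  qed (use \<open>\<alpha> > 0\<close> \<open>s \<le> t\<close> in auto)
  then show ?thesis
    by (simp add: left_sums_converge_iff_riemann I_def)
qed

lemma young_integral_eqI:
  assumes "left_sums_converge Y Z s t J" "s \<le> t"
  shows "young_integral Y Z s t = J"
  unfolding young_integral_def has_young_integral_def
  using assms by (auto simp: left_sums_converge_iff_riemann intro: riemann_sums_converge_unique)

text \<open>
  The \<open>k\<close>-th power of \<open>z \<le> exp z\<close> at \<open>z = x / (2 * k)\<close>; half of the exponential decay is left over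
  for integrability.
\<close>

lemma power_le_exp_half:
  fixes x :: real
  assumes "x \<ge> 0"
  shows "x ^ k \<le> (2 * real k) ^ k * exp (x / 2)"
proof (cases "k = 0")
  case False
  have "x \<le> 2 * real k * exp (x / (2 * real k))"
  proof -
    have "x / (2 * real k) \<le> exp (x / (2 * real k))"
      using exp_ge_add_one_self[of "x / (2 * real k)"] by linarith
    then show ?thesis
      using False by (simp add: field_simps)
  qed
  then have "x ^ k \<le> (2 * real k * exp (x / (2 * real k))) ^ k"
    using assms by (rule power_mono)
  also have "\<dots> = (2 * real k) ^ k * exp (x / 2)"
    using False by (simp add: power_mult_distrib flip: exp_of_nat_mult)
  finally show ?thesis .
qed (use assms in simp)

lemma absolutely_integrable_exp_polynomial_growth:
  fixes \<beta> :: "real \<Rightarrow> real"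
  assumes "polynomial_growth \<beta>" "continuous_on UNIV \<beta>"
  shows "(\<lambda>r. exp r * \<beta> r) absolutely_integrable_on {..t}"
proof -
  obtain C k where C: "\<And>r. \<bar>\<beta> r\<bar> \<le> C * (1 + \<bar>r\<bar> ^ k)"
    using assms(1) unfolding polynomial_growth_def by blast
  \<comment> \<open>The last factor accounts for positive \<open>r\<close>: \<open>r + \<bar>r\<bar> / 2 \<le> \<bar>t\<bar> + r / 2\<close> for \<open>r \<le> t\<close>.\<close>
  define K where "K = \<bar>C\<bar> * (1 + (2 * real k) ^ k) * exp \<bar>t\<bar>"
  have bound: "norm (exp r * \<beta> r) \<le> K * exp (r / 2)" if "r \<in> {..t}" for r
  proof -
    have "1 + \<bar>r\<bar> ^ k \<le> exp (\<bar>r\<bar> / 2) + (2 * real k) ^ k * exp (\<bar>r\<bar> / 2)"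
      by (intro add_mono power_le_exp_half) auto
    also have "\<dots> = (1 + (2 * real k) ^ k) * exp (\<bar>r\<bar> / 2)"
      by (simp add: algebra_simps)
    finally have "C * (1 + \<bar>r\<bar> ^ k) \<le> \<bar>C\<bar> * ((1 + (2 * real k) ^ k) * exp (\<bar>r\<bar> / 2))"
      by (intro mult_mono) auto
    with C[of r] have "\<bar>\<beta> r\<bar> \<le> \<bar>C\<bar> * ((1 + (2 * real k) ^ k) * exp (\<bar>r\<bar> / 2))"
      by linarith
    then have "exp r * \<bar>\<beta> r\<bar> \<le> exp r * (\<bar>C\<bar> * ((1 + (2 * real k) ^ k) * exp (\<bar>r\<bar> / 2)))"
      by (rule mult_left_mono) simp
    also have "\<dots> = \<bar>C\<bar> * (1 + (2 * real k) ^ k) * exp (r + \<bar>r\<bar> / 2)"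
      by (simp add: exp_add)
    also have "\<dots> \<le> \<bar>C\<bar> * (1 + (2 * real k) ^ k) * exp (\<bar>t\<bar> + r / 2)"
      using that by (intro mult_left_mono) auto
    finally show ?thesis
      by (simp add: K_def exp_add abs_mult)
  qed
  have "(\<lambda>r::real. exp (- (1 / 2) * r)) absolutely_integrable_on {-t..}"
    by (intro nonnegative_absolutely_integrable_1 integrable_on_exp_minus_to_infinity) auto
  then have "(\<lambda>r::real. exp (r / 2)) absolutely_integrable_on {..t}"
    using has_absolute_integral_reflect_real[of "{-t..}" "{..t}" "\<lambda>r. exp (r / 2)"] by auto
  then have "(\<lambda>r. K * exp (r / 2)) integrable_on {..t}"
    by (intro integrable_on_mult_right set_lebesgue_integral_eq_integral(1))
  then show ?thesis
    using bound assms(2)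
    by (intro measurable_bounded_by_integrable_imp_absolutely_integrable
        continuous_imp_measurable_on_sets_lebesgue continuous_intros)
       (auto intro: continuous_on_subset)
qed

context
  fixes \<alpha> :: real and \<beta> :: "real \<Rightarrow> real"
  assumes holder: "\<And>S T. holder_on \<alpha> {S..T} \<beta>" and \<alpha>: "0 < \<alpha>" and growth: "polynomial_growth \<beta>"
begin

lemma continuous_driver: "continuous_on A \<beta>"
proof -
  have "isCont \<beta> t" for t
  proof -
    have "continuous_on {t - 1<..<t + 1} \<beta>"
      using holder_on_imp_continuous_on[OF holder \<alpha>, of "t - 1" "t + 1"]
      by (rule continuous_on_subset) auto
    then show ?thesis
      by (auto simp: continuous_on_eq_continuous_at)
  qed
  then show ?thesis
    by (simp add: continuous_at_imp_continuous_on)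
qed

lemma fOU_eq: "fOU \<beta> t = \<beta> t - exp (- t) * integral {..t} (\<lambda>r. exp r * \<beta> r)"
proof -
  let ?g = "\<lambda>r. exp r * \<beta> r"
  have int: "?g absolutely_integrable_on {..t}"
    by (rule absolutely_integrable_exp_polynomial_growth[OF growth continuous_driver])
  have "((\<lambda>T. set_lebesgue_integral lebesgue {T..t} ?g) \<longlongrightarrow> set_lebesgue_integral lebesgue {..t} ?g) at_bot"
    by (intro tendsto_set_lebesgue_integral_at_bot int) simp
  moreover have "set_lebesgue_integral lebesgue {T..t} ?g = integral {T..t} ?g" for T
    by (intro set_lebesgue_integral_eq_integral(2) absolutely_integrable_on_subinterval[OF int]) auto
  ultimately have lim: "((\<lambda>T. integral {T..t} ?g) \<longlongrightarrow> integral {..t} ?g) at_bot"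
    by (simp add: set_lebesgue_integral_eq_integral(2)[OF int])
  have boundary: "((\<lambda>T. exp T * \<beta> T) \<longlongrightarrow> 0) at_bot"
  proof -
    obtain C k where C: "\<And>r. \<bar>\<beta> r\<bar> \<le> C * (1 + \<bar>r\<bar> ^ k)"
      using growth unfolding polynomial_growth_def by blast
    have "((\<lambda>x::real. exp (- x) * (C * (1 + x ^ k))) \<longlongrightarrow> 0) at_top"
    proof -
      have "((\<lambda>x::real. C * (x ^ 0 / exp x + x ^ k / exp x)) \<longlongrightarrow> C * (0 + 0)) at_top"
        by (intro tendsto_intros tendsto_power_div_exp_0)
      then show ?thesis
        by (simp add: exp_minus field_simps)
    qed
    moreover have "eventually (\<lambda>x. norm (exp (- x) * \<beta> (- x)) \<le> exp (- x) * (C * (1 + x ^ k))) at_top"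
      using eventually_ge_at_top[of 0]
    proof eventually_elim
      case (elim x)
      have "exp (- x) * \<bar>\<beta> (- x)\<bar> \<le> exp (- x) * (C * (1 + \<bar>- x\<bar> ^ k))"
        by (intro mult_left_mono C) simp
      with elim show ?case by (simp add: abs_mult)
    qed
    ultimately have "((\<lambda>x. exp (- x) * \<beta> (- x)) \<longlongrightarrow> 0) at_top"
      by (rule Lim_null_comparison[rotated])
    then show ?thesis
      by (simp add: filterlim_at_bot_mirror)
  qed
  have "((\<lambda>T. young_integral exp \<beta> T t) \<longlongrightarrow> exp t * \<beta> t - 0 - integral {..t} ?g) at_bot"
  proof (rule Lim_transform_eventually)
    show "((\<lambda>T. exp t * \<beta> t - exp T * \<beta> T - integral {T..t} ?g) \<longlongrightarrow> exp t * \<beta> t - 0 - integral {..t} ?g) at_bot"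
      by (intro tendsto_intros boundary lim)
    show "eventually (\<lambda>T. exp t * \<beta> t - exp T * \<beta> T - integral {T..t} ?g = young_integral exp \<beta> T t) at_bot"
      using eventually_le_at_bot[of t]
      by eventually_elim (simp add: young_integral_eqI[OF left_sums_converge_exp[OF holder \<alpha>]])
  qed
  then have "Lim at_bot (\<lambda>T. young_integral exp \<beta> T t) = exp t * \<beta> t - integral {..t} ?g"
    by (intro tendsto_Lim) auto
  then show ?thesis
    by (simp add: fOU_def right_diff_distrib mult.assoc[symmetric] flip: exp_add)
qed

text \<open>
  The difference \<open>\<beta> - fOU \<beta>\<close> is \<open>exp (- t)\<close> times the integral of \<open>exp r * \<beta> r\<close> up to \<open>t\<close>, a
  continuously differentiable function with derivative \<open>fOU \<beta>\<close>.
\<close>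

lemma fOU_langevin:
  assumes "s \<le> t"
  shows "(fOU \<beta> has_integral (\<beta> t - \<beta> s - (fOU \<beta> t - fOU \<beta> s))) {s..t}"
proof -
  let ?g = "\<lambda>r. exp r * \<beta> r"
  define D where "D r = exp (- r) * integral {..r} ?g" for r
  have int: "?g absolutely_integrable_on {..r}" for r
    by (rule absolutely_integrable_exp_polynomial_growth[OF growth continuous_driver])
  have split: "integral {..r} ?g = integral {..s} ?g + integral {s..r} ?g" if "s \<le> r" for r
  proof -
    have "{..r} = {..s} \<union> {s..r}" "{..s} \<inter> {s..r} = {s}"
      using that by auto
    then show ?thesis
      by (simp add: set_lebesgue_integral_eq_integral(1)[OF int]
          integrable_continuous_interval continuous_driver continuous_intros)
  qed
  have "(D has_vector_derivative fOU \<beta> r) (at r within {s..t})" if r: "r \<in> {s..t}" for r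
  proof -
    define F where "F x = integral {s..x} ?g" for x
    have F: "(F has_real_derivative ?g r) (at r within {s..t})"
      unfolding F_def using r
      by (intro integral_has_real_derivative continuous_intros continuous_driver)
    have "((\<lambda>x. exp (- x) * (integral {..s} ?g + F x)) has_real_derivative
        exp (- r) * ?g r - exp (- r) * (integral {..s} ?g + F r)) (at r within {s..t})"
      by (rule derivative_eq_intros F refl | simp)+
    moreover have D_eq: "D x = exp (- x) * (integral {..s} ?g + F x)" if "s \<le> x" for x
      by (simp only: D_def F_def split[OF that])
    ultimately have "(D has_real_derivative
        exp (- r) * ?g r - exp (- r) * (integral {..s} ?g + F r)) (at r within {s..t})"
      by (elim has_field_derivative_transform_within[OF _ zero_less_one])
         (use r in \<open>auto simp: D_eq\<close>)
    also have "exp (- r) * ?g r - exp (- r) * (integral {..s} ?g + F r) = fOU \<beta> r"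
      using r D_eq[of r] by (simp add: fOU_eq D_def mult.assoc[symmetric] flip: exp_add)
    finally show ?thesis
      by (simp add: has_real_derivative_iff_has_vector_derivative)
  qed
  then have "(fOU \<beta> has_integral (D t - D s)) {s..t}"
    using assms by (intro fundamental_theorem_of_calculus)
  moreover have "D t - D s = \<beta> t - \<beta> s - (fOU \<beta> t - fOU \<beta> s)"
    by (simp add: D_def fOU_eq)
  ultimately show ?thesis by simp
qed

text \<open>
  An increment of \<open>fOU \<beta>\<close> is one of \<open>\<beta>\<close> minus an integral of order one.
\<close>

lemma holder_on_fOU:
  assumes "\<alpha> \<le> 1"
  shows "holder_on \<alpha> {S..T} (fOU \<beta>)"
proof (cases "S \<le> T")
  case True
  have "germ_order \<alpha> {S..T} (\<lambda>s t. integral {s..t} (fOU \<beta>))"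
  proof (rule germ_order_antimono[OF germ_order_integral_bounded assms])
    show "fOU \<beta> integrable_on {S..T}"
      using fOU_langevin[OF True] by blast
    have "continuous_on {S..T} (\<lambda>t. integral {S..t} (fOU \<beta>))"
      using fOU_langevin[OF True] by (intro indefinite_integral_continuous_1) blast
    then have "continuous_on {S..T} (\<lambda>t. fOU \<beta> S + (\<beta> t - \<beta> S) - integral {S..t} (fOU \<beta>))"
      by (intro continuous_intros continuous_driver)
    then have "continuous_on {S..T} (fOU \<beta>)"
      by (rule continuous_on_eq) (simp add: integral_unique[OF fOU_langevin])
    then show "bounded (fOU \<beta> ` {S..T})"
      by (intro compact_imp_bounded compact_continuous_image) auto
  qed
  then have "germ_order \<alpha> {S..T} (\<lambda>s t. (\<beta> t - \<beta> s) - integral {s..t} (fOU \<beta>))"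
    using germ_order_diff holder[of S T] unfolding holder_on_iff_germ_order by blast
  then show ?thesis
    unfolding holder_on_iff_germ_order
    by (subst (asm) germ_order_cong[where F="\<lambda>s t. fOU \<beta> t - fOU \<beta> s"])
       (simp_all add: integral_unique[OF fOU_langevin])
qed (simp add: holder_on_def)

end

section \<open>The two equations up to negligible germs\<close>

lemma interval_lebesgue_integrable_iff_absolutely_integrable:
  fixes h :: "real \<Rightarrow> 'a::euclidean_space"
  shows "interval_lebesgue_integrable lebesgue (ereal s) (ereal t) h \<longleftrightarrow>
    h absolutely_integrable_on {min s t..max s t}"
  using absolutely_integrable_on_open_interval[of s t h] absolutely_integrable_on_open_interval[of t s h]
  by (auto simp: interval_lebesgue_integrable_def min_def max_def)

lemma interval_lebesgue_integral_eq_integral: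
  fixes h :: "real \<Rightarrow> 'a::euclidean_space"
  assumes "h absolutely_integrable_on {s..t}" "s \<le> t"
  shows "(LINT r=ereal s..ereal t|lebesgue. h r) = integral {s..t} h"
    and "(LINT r=ereal t..ereal s|lebesgue. h r) = - integral {s..t} h"
proof -
  have "h absolutely_integrable_on {s<..<t}"
    using assms(1) absolutely_integrable_on_open_interval[of s t h] by simp
  then have *: "(LINT r:{s<..<t}|lebesgue. h r) = integral {s..t} h"
    by (simp add: set_lebesgue_integral_eq_integral(2) integral_open_interval_real)
  then show "(LINT r=ereal s..ereal t|lebesgue. h r) = integral {s..t} h"
    using assms(2) by (simp add: interval_lebesgue_integral_def)
  show "(LINT r=ereal t..ereal s|lebesgue. h r) = - integral {s..t} h"
    using assms(2) * by (cases "s = t") (auto simp: interval_lebesgue_integral_def)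
qed

text \<open>
  Exchanging \<open>s\<close> and \<open>t\<close> changes the sign of both sides, so ordered pairs of times suffice; on these the
  oriented Lebesgue integral is a gauge integral.
\<close>

lemma solves_ode_iff_forward:
  assumes "S \<le> T"
  shows "solves_ode g {S..T} u \<longleftrightarrow> (\<lambda>r. g r (u r)) absolutely_integrable_on {S..T} \<and>
    (\<forall>s\<in>{S..T}. \<forall>t\<in>{S..T}. s \<le> t \<longrightarrow> u t - u s = integral {s..t} (\<lambda>r. g r (u r)))"
    (is "_ \<longleftrightarrow> ?int \<and> ?eq")
proof (intro iffI conjI)
  assume sol: "solves_ode g {S..T} u"
  then have "interval_lebesgue_integrable lebesgue (ereal S) (ereal T) (\<lambda>r. g r (u r))"
    using assms unfolding solves_ode_def by simp
  then show int: ?int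
    using assms by (simp add: interval_lebesgue_integrable_iff_absolutely_integrable)
  show ?eq
  proof (intro ballI impI)
    fix s t assume st: "s \<in> {S..T}" "t \<in> {S..T}" "s \<le> t"
    then have "(\<lambda>r. g r (u r)) absolutely_integrable_on {s..t}"
      by (intro absolutely_integrable_on_subinterval[OF int]) auto
    then show "u t - u s = integral {s..t} (\<lambda>r. g r (u r))"
      using sol st unfolding solves_ode_def by (simp add: interval_lebesgue_integral_eq_integral(1))
  qed
next
  assume "?int \<and> ?eq"
  then have int: ?int and eq: ?eq by auto
  show "solves_ode g {S..T} u"
    unfolding solves_ode_def
  proof (intro ballI conjI)
    fix s t assume st: "s \<in> {S..T}" "t \<in> {S..T}"
    then have mm: "(\<lambda>r. g r (u r)) absolutely_integrable_on {min s t..max s t}"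
      by (intro absolutely_integrable_on_subinterval[OF int]) auto
    then show "interval_lebesgue_integrable lebesgue (ereal s) (ereal t) (\<lambda>r. g r (u r))"
      by (simp add: interval_lebesgue_integrable_iff_absolutely_integrable)
    show "u t - u s = (LINT r=ereal s..ereal t|lebesgue. g r (u r))"
    proof (cases "s \<le> t")
      case True
      then show ?thesis
        using mm eq st by (simp add: interval_lebesgue_integral_eq_integral(1))
    next
      case False
      then have "u s - u t = integral {t..s} (\<lambda>r. g r (u r))"
        using eq st by auto
      then show ?thesis
        using mm False by (simp add: interval_lebesgue_integral_eq_integral(2) algebra_simps)
    qed
  qed
qed

text \<open>
  The solution property prescribes the value of the Young integral, so the existential quantifier over
  it can be dropped.
\<close>

lemma solves_sde_iff_forward:
  assumes "S \<le> T"
  shows "solves_sde f a b \<beta> {S..T} x \<longleftrightarrow> (\<lambda>r. f (x r)) absolutely_integrable_on {S..T} \<and>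
    (\<forall>s\<in>{S..T}. \<forall>t\<in>{S..T}. s \<le> t \<longrightarrow>
       left_sums_converge (\<lambda>r. a *\<^sub>R x r + b) \<beta> s t (x t - x s - integral {s..t} (\<lambda>r. f (x r))))"
    (is "_ \<longleftrightarrow> ?int \<and> ?eq")
proof (intro iffI conjI)
  assume sol: "solves_sde f a b \<beta> {S..T} x"
  then have "interval_lebesgue_integrable lebesgue (ereal S) (ereal T) (\<lambda>r. f (x r))"
    using assms unfolding solves_sde_def by simp
  then show int: ?int
    using assms by (simp add: interval_lebesgue_integrable_iff_absolutely_integrable)
  show ?eq
  proof (intro ballI impI)
    fix s t assume st: "s \<in> {S..T}" "t \<in> {S..T}" "s \<le> t"
    then have sub: "(\<lambda>r. f (x r)) absolutely_integrable_on {s..t}"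
      by (intro absolutely_integrable_on_subinterval[OF int]) auto
    obtain J where J: "has_young_integral (\<lambda>r. a *\<^sub>R x r + b) \<beta> s t J"
      "x t - x s = (LINT r=ereal s..ereal t|lebesgue. f (x r)) + J"
      using sol st(1,2) unfolding solves_sde_def by blast
    from J(2) have "J = x t - x s - integral {s..t} (\<lambda>r. f (x r))"
      using sub st(3) by (simp add: interval_lebesgue_integral_eq_integral(1))
    with J(1) st(3) show
      "left_sums_converge (\<lambda>r. a *\<^sub>R x r + b) \<beta> s t (x t - x s - integral {s..t} (\<lambda>r. f (x r)))"
      by (simp add: has_young_integral_def)
  qed
next
  assume "?int \<and> ?eq"
  then have int: ?int and eq: ?eq by auto
  show "solves_sde f a b \<beta> {S..T} x"
    unfolding solves_sde_def
  proof (intro ballI conjI)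
    fix s t assume st: "s \<in> {S..T}" "t \<in> {S..T}"
    then have mm: "(\<lambda>r. f (x r)) absolutely_integrable_on {min s t..max s t}"
      by (intro absolutely_integrable_on_subinterval[OF int]) auto
    then show "interval_lebesgue_integrable lebesgue (ereal s) (ereal t) (\<lambda>r. f (x r))"
      by (simp add: interval_lebesgue_integrable_iff_absolutely_integrable)
    show "\<exists>J. has_young_integral (\<lambda>r. a *\<^sub>R x r + b) \<beta> s t J \<and>
        x t - x s = (LINT r=ereal s..ereal t|lebesgue. f (x r)) + J"
    proof (intro exI conjI)
      let ?J = "x t - x s - (LINT r=ereal s..ereal t|lebesgue. f (x r))"
      show "x t - x s = (LINT r=ereal s..ereal t|lebesgue. f (x r)) + ?J"
        by simp
      show "has_young_integral (\<lambda>r. a *\<^sub>R x r + b) \<beta> s t ?J"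
      proof (cases "s \<le> t")
        case True
        then show ?thesis
          using mm eq st by (simp add: has_young_integral_def interval_lebesgue_integral_eq_integral(1))
      next
        case False
        then have "left_sums_converge (\<lambda>r. a *\<^sub>R x r + b) \<beta> t s
            (x s - x t - integral {t..s} (\<lambda>r. f (x r)))"
          using eq st by auto
        then show ?thesis
          using mm False
          by (simp add: has_young_integral_def interval_lebesgue_integral_eq_integral(2) algebra_simps)
      qed
    qed
  qed
qed

lemma increment_minus_integral_additive:
  fixes u h :: "real \<Rightarrow> 'a::euclidean_space"
  assumes "h absolutely_integrable_on {S..T}" "S \<le> r" "r \<le> s" "s \<le> t" "t \<le> T"
  shows "u t - u r - integral {r..t} h = (u s - u r - integral {r..s} h) + (u t - u s - integral {s..t} h)"
proof -
  have "h absolutely_integrable_on {r..t}"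
    using assms by (intro absolutely_integrable_on_subinterval[OF assms(1)]) auto
  then have "integral {r..s} h + integral {s..t} h = integral {r..t} h"
    using assms
    by (intro Henstock_Kurzweil_Integration.integral_combine set_lebesgue_integral_eq_integral(1))
  then show ?thesis by (simp add: algebra_simps)
qed

text \<open>
  The defect is additive in the interval. If it is of order larger than one, it is approximated by the
  zero germ and hence equals zero.
\<close>

lemma solves_ode_iff_germ_order:
  assumes "S \<le> T" "\<theta> > 1"
  shows "solves_ode g {S..T} u \<longleftrightarrow> (\<lambda>r. g r (u r)) absolutely_integrable_on {S..T} \<and>
    germ_order \<theta> {S..T} (\<lambda>s t. u t - u s - integral {s..t} (\<lambda>r. g r (u r)))"
    (is "_ \<longleftrightarrow> ?int \<and> ?small")
proof -
  define D where "D s t = u t - u s - integral {s..t} (\<lambda>r. g r (u r))" for s t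
  have "(\<forall>s\<in>{S..T}. \<forall>t\<in>{S..T}. s \<le> t \<longrightarrow> u t - u s = integral {s..t} (\<lambda>r. g r (u r)))
      \<longleftrightarrow> germ_order \<theta> {S..T} D" if int: ?int
  proof
    assume "\<forall>s\<in>{S..T}. \<forall>t\<in>{S..T}. s \<le> t \<longrightarrow> u t - u s = integral {s..t} (\<lambda>r. g r (u r))"
    then show "germ_order \<theta> {S..T} D"
      by (intro germ_orderI[where C=0]) (auto simp: D_def)
  next
    assume small: "germ_order \<theta> {S..T} D"
    show "\<forall>s\<in>{S..T}. \<forall>t\<in>{S..T}. s \<le> t \<longrightarrow> u t - u s = integral {s..t} (\<lambda>r. g r (u r))"
    proof (intro ballI impI)
      fix s t assume st: "s \<in> {S..T}" "t \<in> {S..T}" "s \<le> t"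
      have "riemann_sums_converge (\<lambda>_ _. 0) s t (D s t)"
      proof (rule riemann_sums_converge_additive)
        show "germ_order \<theta> {s..t} (\<lambda>u v. D u v - 0)"
          using st germ_order_subset[OF small, of "{s..t}"] by simp
        show "D r v = D r w + D w v" if "s \<le> r" "r \<le> w" "w \<le> v" "v \<le> t" for r w v
          unfolding D_def using that st
          by (intro increment_minus_integral_additive[OF int]) auto
      qed (use st assms in auto)
      moreover have "riemann_sums_converge (\<lambda>_ _. 0::'a) s t 0"
        unfolding riemann_sums_converge_def by (auto intro: exI[of _ 1])
      ultimately have "D s t = 0"
        using st(3) by (rule riemann_sums_converge_unique)
      then show "u t - u s = integral {s..t} (\<lambda>r. g r (u r))"
        by (simp add: D_def)
    qed
  qed
  then show ?thesis
    unfolding solves_ode_iff_forward[OF assms(1)] D_def by blast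
qed

text \<open>
  If \<open>x\<close> solves the equation, the Young integral is within order \<open>2 * \<alpha>\<close> of its left-point
  approximation. Conversely, \<open>x t - x s\<close> minus the drift integral is additive in the interval, so
  closeness to the left-point germ alone makes it the limit of the left-point sums.
\<close>

lemma solves_sde_iff_germ_order:
  assumes "S \<le> T" "\<alpha> > 1 / 2" and x: "holder_on \<alpha> {S..T} x" and \<beta>: "holder_on \<alpha> {S..T} \<beta>"
  shows "solves_sde f a b \<beta> {S..T} x \<longleftrightarrow> (\<lambda>r. f (x r)) absolutely_integrable_on {S..T} \<and>
    germ_order (2 * \<alpha>) {S..T} (\<lambda>s t. x t - x s - integral {s..t} (\<lambda>r. f (x r))
      - (\<beta> t - \<beta> s) *\<^sub>R (a *\<^sub>R x s + b))"
    (is "_ \<longleftrightarrow> ?int \<and> ?small")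
proof -
  define J where "J s t = x t - x s - integral {s..t} (\<lambda>r. f (x r))" for s t
  define Y where "Y r = a *\<^sub>R x r + b" for r
  have "(\<forall>s\<in>{S..T}. \<forall>t\<in>{S..T}. s \<le> t \<longrightarrow> left_sums_converge Y \<beta> s t (J s t))
      \<longleftrightarrow> germ_order (2 * \<alpha>) {S..T} (\<lambda>s t. J s t - (\<beta> t - \<beta> s) *\<^sub>R Y s)" if int: ?int
  proof
    assume lim: "\<forall>s\<in>{S..T}. \<forall>t\<in>{S..T}. s \<le> t \<longrightarrow> left_sums_converge Y \<beta> s t (J s t)"
    have "holder_on \<alpha> {S..T} (\<lambda>t. (\<lambda>_. a) t *\<^sub>R x t)"
      using x assms(2) by (intro holder_on_scaleR) (auto simp: holder_on_def intro: exI[of _ 0])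
    then have "holder_on \<alpha> {S..T} Y"
      unfolding Y_def by (rule holder_on_add_const)
    with lim \<beta> assms(2) show "germ_order (2 * \<alpha>) {S..T} (\<lambda>s t. J s t - (\<beta> t - \<beta> s) *\<^sub>R Y s)"
      by (intro young_limit_estimate) auto
  next
    assume small: "germ_order (2 * \<alpha>) {S..T} (\<lambda>s t. J s t - (\<beta> t - \<beta> s) *\<^sub>R Y s)"
    show "\<forall>s\<in>{S..T}. \<forall>t\<in>{S..T}. s \<le> t \<longrightarrow> left_sums_converge Y \<beta> s t (J s t)"
      unfolding left_sums_converge_iff_riemann
    proof (intro ballI impI)
      fix s t assume st: "s \<in> {S..T}" "t \<in> {S..T}" "s \<le> t"
      show "riemann_sums_converge (\<lambda>u v. (\<beta> v - \<beta> u) *\<^sub>R Y u) s t (J s t)"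
      proof (rule riemann_sums_converge_additive)
        show "germ_order (2 * \<alpha>) {s..t} (\<lambda>u v. J u v - (\<beta> v - \<beta> u) *\<^sub>R Y u)"
          using st by (intro germ_order_subset[OF small]) auto
        show "J r v = J r w + J w v" if "s \<le> r" "r \<le> w" "w \<le> v" "v \<le> t" for r w v
          unfolding J_def using that st
          by (intro increment_minus_integral_additive[OF int]) auto
      qed (use st assms(2) in auto)
    qed
  qed
  then show ?thesis
    unfolding solves_sde_iff_forward[OF assms(1)] J_def Y_def by blast
qed

section \<open>The exponential transformation\<close>

lemma absolutely_integrable_continuous_scaleR:
  fixes c :: "real \<Rightarrow> real" and h :: "real \<Rightarrow> 'a::euclidean_space"
  assumes "continuous_on {S..T} c" "h absolutely_integrable_on {S..T}"
  shows "(\<lambda>r. c r *\<^sub>R h r) absolutely_integrable_on {S..T}"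
  using assms
  by (intro absolutely_integrable_bounded_measurable_product[where h=scaleR]
      continuous_imp_measurable_on_sets_lebesgue compact_imp_bounded compact_continuous_image)
     (auto simp: bilinear_conv_bounded_bilinear bounded_bilinear_scaleR)

lemma bounded_linear_growth_image:
  assumes "linear_growth f" "bounded (x ` A)"
  shows "bounded ((\<lambda>r. f (x r)) ` A)"
proof -
  obtain l M where l: "l > 0" "\<And>y. norm (f y) \<le> l * norm y + M"
    using assms(1) unfolding linear_growth_def by blast
  obtain K where K: "\<And>r. r \<in> A \<Longrightarrow> norm (x r) \<le> K"
    using assms(2) unfolding bounded_iff by blast
  have "norm (f (x r)) \<le> l * K + M" if "r \<in> A" for r
  proof -
    have "l * norm (x r) \<le> l * K"
      using K[OF that] l(1) by simp
    with l(2)[of "x r"] show ?thesis by linarith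
  qed
  then show ?thesis
    unfolding bounded_iff by blast
qed

text \<open>
  The path \<open>O\<^sub>U\<close> stands for the Ornstein--Uhlenbeck path of \<open>\<beta>\<close>; it is characterised by the Langevin
  equation on \<open>{S..T}\<close>, so its past before \<open>S\<close> is summarised in its value at \<open>S\<close>.
\<close>

locale exponential_transformation =
  fixes f :: "'a::euclidean_space \<Rightarrow> 'a" and a S T \<alpha> :: real and b :: 'a
    and \<beta> O\<^sub>U :: "real \<Rightarrow> real" and x u :: "real \<Rightarrow> 'a"
  assumes ST: "S \<le> T" and \<alpha>: "1 / 2 < \<alpha>" "\<alpha> \<le> 1" and a: "a \<noteq> 0"
    and growth: "linear_growth f"
    and \<beta>: "holder_on \<alpha> {S..T} \<beta>" and O_holder: "holder_on \<alpha> {S..T} O\<^sub>U"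
    and langevin: "\<And>s t. S \<le> s \<Longrightarrow> s \<le> t \<Longrightarrow> t \<le> T \<Longrightarrow>
      (O\<^sub>U has_integral (\<beta> t - \<beta> s - (O\<^sub>U t - O\<^sub>U s))) {s..t}"
    and u_eq: "\<And>t. t \<in> {S..T} \<Longrightarrow> u t = exp (- a * O\<^sub>U t) *\<^sub>R (x t + b /\<^sub>R a) - b /\<^sub>R a"
begin

text \<open>
  The shift by \<open>b / a\<close> turns the affine coefficient \<open>a x + b\<close> into the linear one \<open>a y\<close>, and the
  transformation into the multiplication \<open>v = e y\<close>. The function \<open>drift\<close> is the right-hand side of
  the ordinary equation along \<open>u\<close>, expressed through \<open>x\<close>.
\<close>

definition e :: "real \<Rightarrow> real" where "e t = exp (- a * O\<^sub>U t)"
definition y :: "real \<Rightarrow> 'a" where "y t = x t + b /\<^sub>R a"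
definition v :: "real \<Rightarrow> 'a" where "v t = u t + b /\<^sub>R a"
definition drift :: "real \<Rightarrow> 'a" where "drift r = e r *\<^sub>R f (x r) + (a * O\<^sub>U r) *\<^sub>R v r"

text \<open>
  In \<open>sde_defect\<close> the Young integral is replaced by its left-point approximation.
\<close>

definition sde_defect :: "real \<Rightarrow> real \<Rightarrow> 'a" where
  "sde_defect s t = x t - x s - integral {s..t} (\<lambda>r. f (x r)) - (\<beta> t - \<beta> s) *\<^sub>R (a *\<^sub>R x s + b)"

definition ode_defect :: "real \<Rightarrow> real \<Rightarrow> 'a" where
  "ode_defect s t = u t - u s - integral {s..t} drift"

lemma v_eq: "t \<in> {S..T} \<Longrightarrow> v t = e t *\<^sub>R y t"
  by (simp add: v_def e_def y_def u_eq)

lemma x_eq: "t \<in> {S..T} \<Longrightarrow> x t = exp (a * O\<^sub>U t) *\<^sub>R v t - b /\<^sub>R a"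
  by (simp add: v_eq e_def y_def flip: exp_add)

lemma holder_scaled_O: "holder_on \<alpha> {S..T} (\<lambda>t. c * O\<^sub>U t)"
proof -
  have "holder_on \<alpha> {S..T} (\<lambda>t. (\<lambda>_. c) t *\<^sub>R O\<^sub>U t)"
    using O_holder \<alpha> by (intro holder_on_scaleR) (auto simp: holder_on_def intro: exI[of _ 0])
  then show ?thesis by simp
qed

lemma holder_exp_O: "holder_on \<alpha> {S..T} (\<lambda>t. exp (c * O\<^sub>U t))"
  using holder_on_exp[OF holder_scaled_O] \<alpha> by simp

lemma holder_e: "holder_on \<alpha> {S..T} e"
  unfolding e_def by (rule holder_exp_O)

lemma holder_iff: "holder_on \<alpha> {S..T} x \<longleftrightarrow> holder_on \<alpha> {S..T} u"
proof
  assume "holder_on \<alpha> {S..T} x"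
  then have "holder_on \<alpha> {S..T} (\<lambda>t. e t *\<^sub>R y t + - (b /\<^sub>R a))"
    unfolding y_def using \<alpha> by (intro holder_on_add_const holder_on_scaleR holder_e) auto
  then show "holder_on \<alpha> {S..T} u"
    by (subst holder_on_cong[where y="\<lambda>t. e t *\<^sub>R y t + - (b /\<^sub>R a)"])
       (auto simp: u_eq e_def y_def)
next
  assume "holder_on \<alpha> {S..T} u"
  then have "holder_on \<alpha> {S..T} (\<lambda>t. exp (a * O\<^sub>U t) *\<^sub>R v t + - (b /\<^sub>R a))"
    unfolding v_def using \<alpha> by (intro holder_on_add_const holder_on_scaleR holder_exp_O) auto
  then show "holder_on \<alpha> {S..T} x"
    by (subst holder_on_cong[where y="\<lambda>t. exp (a * O\<^sub>U t) *\<^sub>R v t + - (b /\<^sub>R a)"])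
       (auto simp: x_eq)
qed

context
  assumes x: "holder_on \<alpha> {S..T} x"
begin

lemma holder_y: "holder_on \<alpha> {S..T} y"
  unfolding y_def by (rule holder_on_add_const[OF x])

lemma holder_v: "holder_on \<alpha> {S..T} v"
  unfolding v_def using holder_iff x by (blast intro: holder_on_add_const)

lemma continuous_O: "continuous_on {S..T} O\<^sub>U" and continuous_v: "continuous_on {S..T} v"
  and continuous_e: "continuous_on {S..T} e"
  using O_holder holder_v holder_e \<alpha> by (auto intro: holder_on_imp_continuous_on)

text \<open>
  The drift arises from \<open>f(x)\<close> by multiplication with a continuous positive function and addition of a
  continuous one; both operations can be undone.
\<close>

lemma drift_integrable_iff:
  "drift absolutely_integrable_on {S..T} \<longleftrightarrow> (\<lambda>r. f (x r)) absolutely_integrable_on {S..T}"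
proof
  have lin: "(\<lambda>r. (a * O\<^sub>U r) *\<^sub>R v r) absolutely_integrable_on {S..T}"
    by (intro absolutely_integrable_continuous_real continuous_intros continuous_O continuous_v)
  {
    assume "(\<lambda>r. f (x r)) absolutely_integrable_on {S..T}"
    then show "drift absolutely_integrable_on {S..T}"
      unfolding drift_def
      by (intro set_integral_add(1) lin absolutely_integrable_continuous_scaleR continuous_e)
  next
    assume "drift absolutely_integrable_on {S..T}"
    then have "(\<lambda>r. drift r - (a * O\<^sub>U r) *\<^sub>R v r) absolutely_integrable_on {S..T}"
      by (rule set_integral_diff(1)[OF _ lin])
    then have "(\<lambda>r. exp (a * O\<^sub>U r) *\<^sub>R (drift r - (a * O\<^sub>U r) *\<^sub>R v r)) absolutely_integrable_on {S..T}"
      by (intro absolutely_integrable_continuous_scaleR continuous_intros continuous_O)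
    moreover have "exp (a * O\<^sub>U r) *\<^sub>R (drift r - (a * O\<^sub>U r) *\<^sub>R v r) = f (x r)" for r
      by (simp add: drift_def e_def flip: exp_add)
    ultimately show "(\<lambda>r. f (x r)) absolutely_integrable_on {S..T}"
      by simp
  }
qed

text \<open>
  Expand the increment of \<open>v = e y\<close> at \<open>s\<close> and substitute \<open>d\<beta> - O dt\<close> for \<open>dO\<close> in the linear part of the
  increment of \<open>e\<close>: the terms with \<open>d\<beta>\<close> cancel. The remaining terms are a product of increments, a
  Taylor remainder, and the error of freezing \<open>e\<close> and \<open>v\<close> at time \<open>s\<close> under the integral.
\<close>

lemma ode_defect_eq:
  assumes int: "(\<lambda>r. f (x r)) absolutely_integrable_on {S..T}"
    and st: "s \<in> {S..T}" "t \<in> {S..T}" "s \<le> t"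
  shows "ode_defect s t - e s *\<^sub>R sde_defect s t =
    (e t - e s) *\<^sub>R (y t - y s)
    + (exp (- a * O\<^sub>U t) - exp (- a * O\<^sub>U s) - exp (- a * O\<^sub>U s) * (- a * O\<^sub>U t - - a * O\<^sub>U s)) *\<^sub>R y s
    - integral {s..t} (\<lambda>r. (e r - e s) *\<^sub>R f (x r) + (a * O\<^sub>U r) *\<^sub>R (v r - v s))"
proof -
  have f_int: "(\<lambda>r. f (x r)) integrable_on {s..t}"
    using st by (intro set_lebesgue_integral_eq_integral(1) absolutely_integrable_on_subinterval[OF int]) auto
  have drift_int: "drift integrable_on {s..t}"
    using st by (intro set_lebesgue_integral_eq_integral(1)
        absolutely_integrable_on_subinterval[OF drift_integrable_iff[THEN iffD2, OF int]]) auto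
  define P where "P = \<beta> t - \<beta> s - (O\<^sub>U t - O\<^sub>U s)"
  let ?R = "integral {s..t} (\<lambda>r. (e r - e s) *\<^sub>R f (x r) + (a * O\<^sub>U r) *\<^sub>R (v r - v s))"
  have "((\<lambda>r. drift r - e s *\<^sub>R f (x r) - (a * O\<^sub>U r) *\<^sub>R v s) has_integral
      (integral {s..t} drift - e s *\<^sub>R integral {s..t} (\<lambda>r. f (x r)) - (a * P) *\<^sub>R v s)) {s..t}"
    unfolding P_def using st
    by (intro has_integral_diff has_integral_cmul has_integral_scaleR_left has_integral_mult_right
        integrable_integral drift_int f_int langevin) auto
  moreover have "(\<lambda>r. drift r - e s *\<^sub>R f (x r) - (a * O\<^sub>U r) *\<^sub>R v s)
      = (\<lambda>r. (e r - e s) *\<^sub>R f (x r) + (a * O\<^sub>U r) *\<^sub>R (v r - v s))"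
    by (simp add: drift_def algebra_simps)
  ultimately have remainder: "?R = integral {s..t} drift - e s *\<^sub>R integral {s..t} (\<lambda>r. f (x r)) - (a * P) *\<^sub>R v s"
    by (simp add: integral_unique)
  have "u r = e r *\<^sub>R y r - b /\<^sub>R a" if "r \<in> {S..T}" for r
    using that by (simp add: v_def flip: v_eq)
  then have ode: "ode_defect s t = e t *\<^sub>R y t - e s *\<^sub>R y s - integral {s..t} drift"
    using st by (simp add: ode_defect_def)
  have sde: "sde_defect s t = y t - y s - integral {s..t} (\<lambda>r. f (x r)) - ((\<beta> t - \<beta> s) * a) *\<^sub>R y s"
  proof -
    have "a *\<^sub>R x s + b = a *\<^sub>R y s"
      using a by (simp add: y_def scaleR_add_right)
    then show ?thesis
      unfolding sde_defect_def by (simp add: y_def)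
  qed
  show ?thesis
    unfolding remainder unfolding ode sde v_eq[OF st(1)] e_def[symmetric] P_def by (simp add: algebra_simps)
qed

text \<open>
  The product of increments and the Taylor remainder have order \<open>2 * \<alpha>\<close>. The frozen integral has order
  \<open>1 + \<alpha>\<close>, because \<open>f\<close> is bounded along the bounded path \<open>x\<close> by linear growth; \<open>\<alpha> \<le> 1\<close> gives
  \<open>2 * \<alpha> \<le> 1 + \<alpha>\<close>.
\<close>

lemma ode_defect_order:
  assumes int: "(\<lambda>r. f (x r)) absolutely_integrable_on {S..T}"
  shows "germ_order (2 * \<alpha>) {S..T} (\<lambda>s t. ode_defect s t - e s *\<^sub>R sde_defect s t)"
proof -
  have "0 < \<alpha>" using \<alpha> by simp
  have 1: "germ_order (2 * \<alpha>) {S..T} (\<lambda>s t. (e t - e s) *\<^sub>R (y t - y s))"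
    using germ_order_scaleR[of \<alpha> _ _ \<alpha>] holder_e holder_y
    unfolding holder_on_iff_germ_order mult_2 by blast
  have 2: "germ_order (2 * \<alpha>) {S..T} (\<lambda>s t.
      (exp (- a * O\<^sub>U t) - exp (- a * O\<^sub>U s) - exp (- a * O\<^sub>U s) * (- a * O\<^sub>U t - - a * O\<^sub>U s)) *\<^sub>R y s)"
    by (intro germ_order_scaleR_bounded holder_on_imp_bounded[OF holder_y \<open>0 < \<alpha>\<close>]
        germ_order_exp_linearization[OF holder_scaled_O \<open>0 < \<alpha>\<close>])
  obtain Ce where Ce: "Ce \<ge> 0"
    "\<And>s t. s \<in> {S..T} \<Longrightarrow> t \<in> {S..T} \<Longrightarrow> s \<le> t \<Longrightarrow> norm (e t - e s) \<le> Ce * (t - s) powr \<alpha>"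
    using holder_e unfolding holder_on_iff_germ_order by (elim germ_orderE) blast
  obtain Cv where Cv: "Cv \<ge> 0"
    "\<And>s t. s \<in> {S..T} \<Longrightarrow> t \<in> {S..T} \<Longrightarrow> s \<le> t \<Longrightarrow> norm (v t - v s) \<le> Cv * (t - s) powr \<alpha>"
    using holder_v unfolding holder_on_iff_germ_order by (elim germ_orderE) blast
  obtain F where F: "\<And>r. r \<in> {S..T} \<Longrightarrow> norm (f (x r)) \<le> F"
    using bounded_linear_growth_image[OF growth holder_on_imp_bounded[OF x \<open>0 < \<alpha>\<close>]]
    unfolding bounded_iff by blast
  obtain K where K: "\<And>r. r \<in> {S..T} \<Longrightarrow> norm (a * O\<^sub>U r) \<le> K"
    using holder_on_imp_bounded[OF holder_scaled_O \<open>0 < \<alpha>\<close>] unfolding bounded_iff by blast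
  have "germ_order (1 + \<alpha>) {S..T}
      (\<lambda>s t. integral {s..t} (\<lambda>r. (e r - e s) *\<^sub>R f (x r) + (a * O\<^sub>U r) *\<^sub>R (v r - v s)))"
  proof (rule germ_order_integral)
    fix s t assume st: "S \<le> s" "s < t" "t \<le> T"
    have sub: "{s..t} \<subseteq> {S..T}" using st by auto
    have cont: "continuous_on {s..t} e" "continuous_on {s..t} O\<^sub>U" "continuous_on {s..t} v"
      using continuous_e continuous_O continuous_v sub by (auto intro: continuous_on_subset)
    have "(\<lambda>r. (e r - e s) *\<^sub>R f (x r)) absolutely_integrable_on {s..t}"
      by (intro absolutely_integrable_continuous_scaleR continuous_intros cont
          absolutely_integrable_on_subinterval[OF int sub])
    then show "(\<lambda>r. (e r - e s) *\<^sub>R f (x r) + (a * O\<^sub>U r) *\<^sub>R (v r - v s)) integrable_on {s..t}"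
      by (intro integrable_add set_lebesgue_integral_eq_integral(1) integrable_continuous_interval
          continuous_intros cont)
    fix r assume r: "r \<in> {s..t}"
    have pw: "(r - s) powr \<alpha> \<le> (t - s) powr \<alpha>"
      using r \<open>0 < \<alpha>\<close> by (intro powr_mono2) auto
    have "norm (e r - e s) \<le> Ce * (t - s) powr \<alpha>" "norm (v r - v s) \<le> Cv * (t - s) powr \<alpha>"
      using Ce(2)[of s r] Cv(2)[of s r] r st
        mult_left_mono[OF pw Ce(1)] mult_left_mono[OF pw Cv(1)] by auto
    then have "norm (e r - e s) * norm (f (x r)) + norm (a * O\<^sub>U r) * norm (v r - v s)
        \<le> (Ce * (t - s) powr \<alpha>) * F + K * (Cv * (t - s) powr \<alpha>)"
      using F[of r] K[of r] r st Ce(1) norm_ge_zero[of "a * O\<^sub>U r"]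
      by (intro add_mono mult_mono) (auto intro: order_trans[OF norm_ge_zero])
    then have "norm ((e r - e s) *\<^sub>R f (x r) + (a * O\<^sub>U r) *\<^sub>R (v r - v s))
        \<le> (Ce * (t - s) powr \<alpha>) * F + K * (Cv * (t - s) powr \<alpha>)"
      by (intro norm_triangle_le) simp
    then show "norm ((e r - e s) *\<^sub>R f (x r) + (a * O\<^sub>U r) *\<^sub>R (v r - v s))
        \<le> (Ce * F + K * Cv) * (t - s) powr \<alpha>"
      by (simp add: algebra_simps)
  qed
  then have 3: "germ_order (2 * \<alpha>) {S..T}
      (\<lambda>s t. integral {s..t} (\<lambda>r. (e r - e s) *\<^sub>R f (x r) + (a * O\<^sub>U r) *\<^sub>R (v r - v s)))"
    using \<alpha> by (elim germ_order_antimono) simp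
  show ?thesis
    by (rule germ_order_cong[THEN iffD2, OF ode_defect_eq[OF int]])
       (assumption | rule germ_order_diff[OF germ_order_add[OF 1 2] 3])+
qed

lemma ode_defect_order_iff:
  assumes int: "(\<lambda>r. f (x r)) absolutely_integrable_on {S..T}"
  shows "germ_order (2 * \<alpha>) {S..T} ode_defect \<longleftrightarrow> germ_order (2 * \<alpha>) {S..T} sde_defect"
proof
  have bounded: "bounded ((\<lambda>t. exp (c * O\<^sub>U t)) ` {S..T})" for c
    using \<alpha> by (intro holder_on_imp_bounded[OF holder_exp_O]) simp
  note diff = ode_defect_order[OF int]
  {
    assume "germ_order (2 * \<alpha>) {S..T} sde_defect"
    from germ_order_add[OF diff germ_order_bounded_scaleR[OF bounded[of "- a"] this]]
    show "germ_order (2 * \<alpha>) {S..T} ode_defect"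
      by (simp add: e_def)
  next
    assume "germ_order (2 * \<alpha>) {S..T} ode_defect"
    from germ_order_bounded_scaleR[OF bounded[of a] germ_order_diff[OF this diff]]
    show "germ_order (2 * \<alpha>) {S..T} sde_defect"
      by (simp add: e_def flip: exp_add)
  }
qed

end

lemma equations_equivalent:
  "(holder_on \<alpha> {S..T} x \<and> solves_sde f a b \<beta> {S..T} x) \<longleftrightarrow>
   (holder_on \<alpha> {S..T} u \<and>
    solves_ode (\<lambda>r w. exp (- a * O\<^sub>U r) *\<^sub>R f (exp (a * O\<^sub>U r) *\<^sub>R w + (exp (a * O\<^sub>U r) - 1) *\<^sub>R (b /\<^sub>R a))
      + O\<^sub>U r *\<^sub>R (a *\<^sub>R w + b)) {S..T} u)"
proof -
  let ?g = "\<lambda>r w. exp (- a * O\<^sub>U r) *\<^sub>R f (exp (a * O\<^sub>U r) *\<^sub>R w + (exp (a * O\<^sub>U r) - 1) *\<^sub>R (b /\<^sub>R a))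
      + O\<^sub>U r *\<^sub>R (a *\<^sub>R w + b)"
  have drift: "?g r (u r) = drift r" if "r \<in> {S..T}" for r
  proof -
    have "exp (a * O\<^sub>U r) *\<^sub>R u r + (exp (a * O\<^sub>U r) - 1) *\<^sub>R (b /\<^sub>R a) = x r"
      using x_eq[OF that] by (simp add: v_def algebra_simps)
    moreover have "O\<^sub>U r *\<^sub>R (a *\<^sub>R u r + b) = (a * O\<^sub>U r) *\<^sub>R v r"
      using a by (simp add: v_def algebra_simps)
    ultimately show ?thesis
      by (simp add: drift_def e_def)
  qed
  have "solves_sde f a b \<beta> {S..T} x \<longleftrightarrow> solves_ode ?g {S..T} u" if x: "holder_on \<alpha> {S..T} x"
  proof -
    have "solves_ode ?g {S..T} u \<longleftrightarrow> (\<lambda>r. ?g r (u r)) absolutely_integrable_on {S..T} \<and>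
        germ_order (2 * \<alpha>) {S..T} (\<lambda>s t. u t - u s - integral {s..t} (\<lambda>r. ?g r (u r)))"
      using \<alpha> by (intro solves_ode_iff_germ_order ST) simp
    also have "(\<lambda>r. ?g r (u r)) absolutely_integrable_on {S..T} \<longleftrightarrow> drift absolutely_integrable_on {S..T}"
      by (intro set_integrable_cong drift refl)
    also have "germ_order (2 * \<alpha>) {S..T} (\<lambda>s t. u t - u s - integral {s..t} (\<lambda>r. ?g r (u r)))
        \<longleftrightarrow> germ_order (2 * \<alpha>) {S..T} ode_defect"
    proof (rule germ_order_cong)
      fix s t assume "s \<in> {S..T}" "t \<in> {S..T}" "s \<le> t"
      then have "integral {s..t} (\<lambda>r. ?g r (u r)) = integral {s..t} drift"
        by (intro Henstock_Kurzweil_Integration.integral_cong drift) auto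
      then show "u t - u s - integral {s..t} (\<lambda>r. ?g r (u r)) = ode_defect s t"
        by (simp add: ode_defect_def)
    qed
    also have "drift absolutely_integrable_on {S..T} \<and> germ_order (2 * \<alpha>) {S..T} ode_defect
        \<longleftrightarrow> (\<lambda>r. f (x r)) absolutely_integrable_on {S..T} \<and> germ_order (2 * \<alpha>) {S..T} sde_defect"
      using drift_integrable_iff[OF x] ode_defect_order_iff[OF x] by blast
    also have "\<dots> \<longleftrightarrow> solves_sde f a b \<beta> {S..T} x"
      unfolding solves_sde_iff_germ_order[OF ST \<alpha>(1) x \<beta>] sde_defect_def[abs_def] ..
    finally show ?thesis by simp
  qed
  then show ?thesis
    using holder_iff by blast
qed

end

theorem theorem3p1:
  fixes M :: "'w measure" and B :: "real \<Rightarrow> 'w \<Rightarrow> real"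
    and H \<alpha> a T1 T2 :: real
    and b :: "real ^ 'd" and f :: "real ^ 'd \<Rightarrow> real ^ 'd"
    and X U :: "real \<Rightarrow> 'w \<Rightarrow> real ^ 'd"
  assumes H: "1 / 2 < H" "H < 1"
    and \<alpha>: "1 / 2 < \<alpha>" "\<alpha> < H"
    and a: "a \<noteq> 0"
    and f: "linear_growth f" "dissipative_lipschitz f" "integrability_condition f"
    and fBm: "fractional_brownian_motion M H B"
    and fBm_holder: "\<And>\<omega> R S. \<omega> \<in> space M \<Longrightarrow> holder_on \<alpha> {R..S} (\<lambda>t. B t \<omega>)"
    and fBm_growth: "\<And>\<omega>. \<omega> \<in> space M \<Longrightarrow> polynomial_growth (\<lambda>t. B t \<omega>)"
    and T: "T1 \<le> T2"
    and U: "\<And>\<omega> t. \<omega> \<in> space M \<Longrightarrow> t \<in> {T1..T2} \<Longrightarrow>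
      U t \<omega> = exp (- a * fOU (\<lambda>s. B s \<omega>) t) *\<^sub>R (X t \<omega> + b /\<^sub>R a) - b /\<^sub>R a"
  shows "\<forall>\<omega>\<in>space M.
    (holder_on \<alpha> {T1..T2} (\<lambda>t. X t \<omega>) \<and>
     solves_sde f a b (\<lambda>t. B t \<omega>) {T1..T2} (\<lambda>t. X t \<omega>))
    \<longleftrightarrow>
    (holder_on \<alpha> {T1..T2} (\<lambda>t. U t \<omega>) \<and>
     solves_ode
       (\<lambda>r u. let Or = fOU (\<lambda>s. B s \<omega>) r in
          exp (- a * Or) *\<^sub>R f (exp (a * Or) *\<^sub>R u + (exp (a * Or) - 1) *\<^sub>R (b /\<^sub>R a))
          + Or *\<^sub>R (a *\<^sub>R u + b))
       {T1..T2} (\<lambda>t. U t \<omega>))"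
proof
  fix \<omega> assume \<omega>: "\<omega> \<in> space M"
  let ?\<beta> = "\<lambda>t. B t \<omega>"
  have "0 < \<alpha>" "\<alpha> \<le> 1"
    using H \<alpha> by auto
  interpret exponential_transformation f a T1 T2 \<alpha> b ?\<beta> "fOU ?\<beta>" "\<lambda>t. X t \<omega>" "\<lambda>t. U t \<omega>"
  proof
    show "holder_on \<alpha> {T1..T2} (fOU ?\<beta>)"
      by (rule holder_on_fOU[OF fBm_holder[OF \<omega>] \<open>0 < \<alpha>\<close> fBm_growth[OF \<omega>] \<open>\<alpha> \<le> 1\<close>])
    show "(fOU ?\<beta> has_integral (?\<beta> t - ?\<beta> s - (fOU ?\<beta> t - fOU ?\<beta> s))) {s..t}" if "s \<le> t" for s t
      by (rule fOU_langevin[OF fBm_holder[OF \<omega>] \<open>0 < \<alpha>\<close> fBm_growth[OF \<omega>] that])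
  qed (use T \<alpha> \<open>\<alpha> \<le> 1\<close> a f(1) fBm_holder[OF \<omega>] U[OF \<omega>] in auto)
  show "(holder_on \<alpha> {T1..T2} (\<lambda>t. X t \<omega>) \<and>
     solves_sde f a b (\<lambda>t. B t \<omega>) {T1..T2} (\<lambda>t. X t \<omega>))
    \<longleftrightarrow>
    (holder_on \<alpha> {T1..T2} (\<lambda>t. U t \<omega>) \<and>
     solves_ode
       (\<lambda>r u. let Or = fOU (\<lambda>s. B s \<omega>) r in
          exp (- a * Or) *\<^sub>R f (exp (a * Or) *\<^sub>R u + (exp (a * Or) - 1) *\<^sub>R (b /\<^sub>R a))
          + Or *\<^sub>R (a *\<^sub>R u + b))
       {T1..T2} (\<lambda>t. U t \<omega>))"
    unfolding Let_def by (rule equations_equivalent)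
qed

end
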